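(* Let $\mathcal{H}=\mathcal{H}_1\oplus\mathcal{H}_2$ and let $$\mathcal{A}=\begin{pmatrix}A&B\\C&D\end{pmatrix},\qquad\operatorname{dom}\mathcal{A}=(\operatorname{dom}A\cap\operatorname{dom}C)\oplus(\operatorname{dom}B\cap\operatorname{dom}D),$$ be a densely defined operator matrix in $\mathcal{H}$ with densely defined closable entries and $C\subseteq B^*$. Assume that there exist $\alpha,\delta\in\mathbb{R}$ and semi-angles $\varphi,\psi\in[0,\pi/2]$ with $$\operatorname{Re}W(D)\le\delta<0<\alpha\le\operatorname{Re}W(A),\qquad W(A)\subseteq\Sigma_\varphi,\qquad W(D)\subseteq-\Sigma_\psi,$$ and let $\tau:=\max\{\varphi,\psi\}$. Suppose that one of the following holds: (i$'$) $A$, $-D$ are m-sectorial with vertex $0$, i.e. $\varphi,\psi<\pi/2$, $C$ is $A$-bounded with relative bound $\delta_A$ and $B$ is $D$-bounded with relative bound $\delta_D$ such that $$\delta_A\delta_D<\sin(\theta_0-\varphi)\sin(\theta_0+\psi)=:M_{\theta_0}\in(0,1],$$ where $$\theta_0:=\begin{cases}\max\{\frac\pi2+\frac{\varphi-\psi}2,\tau\},&\varphi\le\psi,\\ \min\{\frac\pi2+\frac{\varphi-\psi}2,\pi-\tau\},&\psi<\varphi;\end{cases}$$ (ii$'$) $A$, $-D$ are m-accretive, $C=B^*$, $A$ is $C$-bounded with relative bound $\delta_C$, $D$ is $B$-bounded with relative bound $\delta_B$ with $\delta_B\delta_C<1$, $B$, $C$ are boundedly invertible, and there are relative boundedness constants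 $a_C,a_B\ge0$, $b_C,b_B\ge0$ with $$\|Ax\|^2\le a_C^2\|x\|^2+b_C^2\|Cx\|^2,\ x\in\operatorname{dom}C,\qquad\|Dy\|^2\le a_B^2\|y\|^2+b_B^2\|By\|^2,\ y\in\operatorname{dom}B,$$ satisfying $$\sqrt{a_C^2\|B^{-1}\|^2+b_C^2}\,\sqrt{a_B^2\|B^{-1}\|^2+b_B^2}<1.$$ Then, with $\Sigma:=(-\Sigma_\tau\cup\Sigma_\tau)\cap\{z\in\mathbb{C}:\operatorname{Re}z\notin(\delta,\alpha)\}$, we have $\rho(\mathcal{A})\cap(\mathbb{C}\setminus\Sigma)\ne\emptyset$ and hence $\sigma(\mathcal{A})\subseteq\Sigma$.
   Context: $\mathcal{H}_1,\mathcal{H}_2$ are complex Hilbert spaces; $A$ acts in $\mathcal{H}_1$, $D$ in $\mathcal{H}_2$, $B$ from $\mathcal{H}_2$ to $\mathcal{H}_1$, $C$ from $\mathcal{H}_1$ to $\mathcal{H}_2$. $W(T)=\{(Tf,f):f\in\operatorname{dom}T,\|f\|=1\}$; inequalities such as $\operatorname{Re}W(D)\le\delta$ are meant for all elements of the set. $\Sigma_\omega=\{z\in\mathbb{C}:|\arg z|\le\omega\}$ for $\omega\in[0,\pi/2]$, with $\arg:\mathbb{C}\to(-\pi,\pi]$ and $\arg0=0$. $T$ is m-accretive if $\operatorname{Re}W(T)\ge0$ and $\rho(T)$ contains a point with negative real part; $T$ is m-sectorial with vertex $0$ and semi-angle $\omega\in[0,\pi/2)$ if $W(T)\subseteq\Sigma_\omega$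 and $\rho(T)\cap(\mathbb{C}\setminus\Sigma_\omega)\ne\emptyset$ (in (i$'$) the semi-angles of $A$, $-D$ are $\varphi$, $\psi$). $S$ is $T$-bounded if $\operatorname{dom}T\subseteq\operatorname{dom}S$ and there are $a,b\ge0$ with $\|Sx\|\le a\|x\|+b\|Tx\|$, $x\in\operatorname{dom}T$; the relative bound is the infimum of all such $b$. "Boundedly invertible" means bijective from the domain onto the target space with bounded inverse. *)

theory Defs
  imports "HOL-Analysis.Analysis"
begin

section \<open>Complex Hilbert spaces\<close>

text \<open>The real inner product and the norm come from \<^class>\<open>real_inner\<close>; \<open>cinner\<close> is linear in its
  first argument.\<close>

class complex_inner = real_inner +
  fixes scaleC :: "complex \<Rightarrow> 'a \<Rightarrow> 'a" (infixr "*\<^sub>C" 75)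
    and cinner :: "'a \<Rightarrow> 'a \<Rightarrow> complex"
  assumes scaleC_add_right: "c *\<^sub>C (x + y) = c *\<^sub>C x + c *\<^sub>C y"
    and scaleC_add_left: "(c + d) *\<^sub>C x = c *\<^sub>C x + d *\<^sub>C x"
    and scaleC_scaleC: "c *\<^sub>C d *\<^sub>C x = (c * d) *\<^sub>C x"
    and scaleR_scaleC: "r *\<^sub>R x = complex_of_real r *\<^sub>C x"
    and cinner_commute: "cinner x y = cnj (cinner y x)"
    and cinner_add_left: "cinner (x + y) z = cinner x z + cinner y z"
    and cinner_scaleC_left: "cinner (c *\<^sub>C x) y = c * cinner x y"
    and inner_eq_Re_cinner: "inner x y = Re (cinner x y)"

class chilbert_space = complex_inner + complete_space

instantiation complex :: chilbert_space
begin

definition scaleC_complex_def: "c *\<^sub>C z = c * (z :: complex)"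

definition cinner_complex_def: "cinner z w = z * cnj w"

instance
  by standard
    (auto simp: scaleC_complex_def cinner_complex_def inner_complex_def scaleR_conv_of_real
      algebra_simps)

end

text \<open>The orthogonal sum of two Hilbert spaces.\<close>

instantiation prod :: (complex_inner, complex_inner) complex_inner
begin

definition scaleC_prod_def: "c *\<^sub>C p = (c *\<^sub>C fst p, c *\<^sub>C snd p)"

definition cinner_prod_def: "cinner p q = cinner (fst p) (fst q) + cinner (snd p) (snd q)"

instance
proof
  fix p q :: "'a \<times> 'b"
  show "cinner p q = cnj (cinner q p)"
    unfolding cinner_prod_def complex_cnj_add
    by (metis cinner_commute)
qed (auto simp: scaleC_prod_def cinner_prod_def inner_prod_def scaleC_add_right scaleC_add_left
      scaleC_scaleC scaleR_prod_def scaleR_scaleC cinner_add_left cinner_scaleC_left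
      inner_eq_Re_cinner algebra_simps)

end

instance prod :: (chilbert_space, chilbert_space) chilbert_space ..


section \<open>Unbounded linear operators\<close>

text \<open>An operator is a partial function; \<open>dom T\<close> is its domain, \<open>S \<subseteq>\<^sub>m T\<close> says that \<open>T\<close> extends \<open>S\<close>,
  and \<open>S = T\<close> includes equality of the domains.\<close>

abbreviation app :: "('a \<rightharpoonup> 'b) \<Rightarrow> 'a \<Rightarrow> 'b" (infixl "\<cdot>" 90)
  where "T \<cdot> x \<equiv> the (T x)"

definition csubspace :: "'a::complex_inner set \<Rightarrow> bool"
  where "csubspace V \<longleftrightarrow>
    0 \<in> V \<and> (\<forall>x\<in>V. \<forall>y\<in>V. x + y \<in> V) \<and> (\<forall>c. \<forall>x\<in>V. c *\<^sub>C x \<in> V)"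

definition linear_operator :: "('a::complex_inner \<rightharpoonup> 'b::complex_inner) \<Rightarrow> bool"
  where "linear_operator T \<longleftrightarrow> csubspace (dom T)
    \<and> (\<forall>x\<in>dom T. \<forall>y\<in>dom T. T \<cdot> (x + y) = T \<cdot> x + T \<cdot> y)
    \<and> (\<forall>c. \<forall>x\<in>dom T. T \<cdot> (c *\<^sub>C x) = c *\<^sub>C (T \<cdot> x))"

definition densely_defined :: "('a::complex_inner \<rightharpoonup> 'b) \<Rightarrow> bool"
  where "densely_defined T \<longleftrightarrow> closure (dom T) = UNIV"

definition closed_operator :: "('a::complex_inner \<rightharpoonup> 'b::complex_inner) \<Rightarrow> bool"
  where "closed_operator T \<longleftrightarrow> linear_operator T \<and> closed (Map.graph T)"

definition closable :: "('a::complex_inner \<rightharpoonup> 'b::complex_inner) \<Rightarrow> bool"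
  where "closable T \<longleftrightarrow> (\<exists>S. closed_operator S \<and> T \<subseteq>\<^sub>m S)"

text \<open>Meaningful for densely defined \<open>T\<close>, for which the vector \<open>z\<close> is unique.\<close>

definition adjoint_op :: "('a::complex_inner \<rightharpoonup> 'b::complex_inner) \<Rightarrow> ('b \<rightharpoonup> 'a)"
  where "adjoint_op T = (\<lambda>y.
    if \<exists>z. \<forall>x\<in>dom T. cinner (T \<cdot> x) y = cinner x z
    then Some (THE z. \<forall>x\<in>dom T. cinner (T \<cdot> x) y = cinner x z)
    else None)"

lemma adjoint_op_eq_Some_iff:
  assumes "densely_defined T"
  shows "adjoint_op T y = Some z \<longleftrightarrow> (\<forall>x\<in>dom T. cinner (T \<cdot> x) y = cinner x z)"
proof -
  have uniq: "z = z'"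
    if z: "\<forall>x\<in>dom T. cinner (T \<cdot> x) y = cinner x z"
      and z': "\<forall>x\<in>dom T. cinner (T \<cdot> x) y = cinner x z'" for z z'
  proof -
    have "inner x z = inner x z'" if "x \<in> dom T" for x
      using z z' that by (metis inner_eq_Re_cinner)
    then have "dom T \<subseteq> {x. inner x (z - z') = 0}"
      by (auto simp: inner_diff_right)
    moreover have "closed {x. inner x (z - z') = 0}"
      by (intro closed_Collect_eq continuous_intros)
    ultimately have "closure (dom T) \<subseteq> {x. inner x (z - z') = 0}"
      by (rule closure_minimal)
    then have "inner (z - z') (z - z') = 0"
      using assms unfolding densely_defined_def by blast
    then show ?thesis by simp
  qed
  have the: "(THE w. \<forall>x\<in>dom T. cinner (T \<cdot> x) y = cinner x w) = w"
    if "\<forall>x\<in>dom T. cinner (T \<cdot> x) y = cinner x w" for w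
    by (rule the_equality) (use that uniq in blast)+
  show ?thesis
  proof
    assume "adjoint_op T y = Some z"
    then obtain w where w: "\<forall>x\<in>dom T. cinner (T \<cdot> x) y = cinner x w"
      and "z = (THE z. \<forall>x\<in>dom T. cinner (T \<cdot> x) y = cinner x z)"
      unfolding adjoint_op_def by (auto split: if_splits)
    then have "z = w" using the[OF w] by simp
    then show "\<forall>x\<in>dom T. cinner (T \<cdot> x) y = cinner x z" using w by simp
  next
    assume z: "\<forall>x\<in>dom T. cinner (T \<cdot> x) y = cinner x z"
    then have "\<exists>z. \<forall>x\<in>dom T. cinner (T \<cdot> x) y = cinner x z" by blast
    then show "adjoint_op T y = Some z"
      unfolding adjoint_op_def using the[OF z] by simp
  qed
qed

definition neg_op :: "('a \<rightharpoonup> 'b::complex_inner) \<Rightarrow> ('a \<rightharpoonup> 'b)"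
  where "neg_op T = (\<lambda>x. map_option uminus (T x))"

definition shift_op :: "('a::complex_inner \<rightharpoonup> 'a) \<Rightarrow> complex \<Rightarrow> ('a \<rightharpoonup> 'a)"
  where "shift_op T z = (\<lambda>x. map_option (\<lambda>y. y - z *\<^sub>C x) (T x))"

definition inverse_op :: "('a \<rightharpoonup> 'b) \<Rightarrow> 'b \<Rightarrow> 'a"
  where "inverse_op T = the_inv_into (dom T) (\<lambda>x. T \<cdot> x)"

definition boundedly_invertible :: "('a::complex_inner \<rightharpoonup> 'b::complex_inner) \<Rightarrow> bool"
  where "boundedly_invertible T \<longleftrightarrow>
    bij_betw (\<lambda>x. T \<cdot> x) (dom T) UNIV \<and> bounded_linear (inverse_op T)"

definition resolvent_set :: "('a::complex_inner \<rightharpoonup> 'a) \<Rightarrow> complex set"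
  where "resolvent_set T = {z. boundedly_invertible (shift_op T z)}"

definition spectrum :: "('a::complex_inner \<rightharpoonup> 'a) \<Rightarrow> complex set"
  where "spectrum T = UNIV - resolvent_set T"

definition numerical_range :: "('a::complex_inner \<rightharpoonup> 'a) \<Rightarrow> complex set"
  where "numerical_range T = {cinner (T \<cdot> f) f | f. f \<in> dom T \<and> norm f = 1}"

definition sector :: "real \<Rightarrow> complex set"
  where "sector \<omega> = {z. \<bar>Arg z\<bar> \<le> \<omega>}"

definition m_accretive :: "('a::complex_inner \<rightharpoonup> 'a) \<Rightarrow> bool"
  where "m_accretive T \<longleftrightarrow>
    (\<forall>z\<in>numerical_range T. 0 \<le> Re z) \<and> (\<exists>z\<in>resolvent_set T. Re z < 0)"

definition m_sectorial :: "real \<Rightarrow> ('a::complex_inner \<rightharpoonup> 'a) \<Rightarrow> bool"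
  where "m_sectorial \<omega> T \<longleftrightarrow> 0 \<le> \<omega> \<and> \<omega> < pi / 2
    \<and> numerical_range T \<subseteq> sector \<omega> \<and> resolvent_set T \<inter> (UNIV - sector \<omega>) \<noteq> {}"

definition rel_bound_consts ::
  "('a::complex_inner \<rightharpoonup> 'b::complex_inner) \<Rightarrow> ('a \<rightharpoonup> 'c::complex_inner) \<Rightarrow> real \<Rightarrow> real \<Rightarrow> bool"
  where "rel_bound_consts S T a b \<longleftrightarrow> 0 \<le> a \<and> 0 \<le> b
    \<and> (\<forall>x\<in>dom T. norm (S \<cdot> x) \<le> a * norm x + b * norm (T \<cdot> x))"

definition rel_bounded ::
  "('a::complex_inner \<rightharpoonup> 'b::complex_inner) \<Rightarrow> ('a \<rightharpoonup> 'c::complex_inner) \<Rightarrow> bool"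
  where "rel_bounded S T \<longleftrightarrow> dom T \<subseteq> dom S \<and> (\<exists>a b. rel_bound_consts S T a b)"

definition relative_bound ::
  "('a::complex_inner \<rightharpoonup> 'b::complex_inner) \<Rightarrow> ('a \<rightharpoonup> 'c::complex_inner) \<Rightarrow> real"
  where "relative_bound S T = Inf {b. \<exists>a. rel_bound_consts S T a b}"

definition block_op ::
  "('a::complex_inner \<rightharpoonup> 'a) \<Rightarrow> ('b::complex_inner \<rightharpoonup> 'a) \<Rightarrow> ('a \<rightharpoonup> 'b) \<Rightarrow> ('b \<rightharpoonup> 'b)
    \<Rightarrow> ('a \<times> 'b \<rightharpoonup> 'a \<times> 'b)"
  where "block_op A B C D = (\<lambda>(x, y).
    if x \<in> dom A \<inter> dom C \<and> y \<in> dom B \<inter> dom D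
    then Some (A \<cdot> x + B \<cdot> y, C \<cdot> x + D \<cdot> y)
    else None)"


section \<open>The angle \<open>\<theta>\<^sub>0\<close> and the constant \<open>M\<close>\<close>

definition theta0 :: "real \<Rightarrow> real \<Rightarrow> real"
  where "theta0 \<phi> \<psi> =
    (if \<phi> \<le> \<psi> then max (pi / 2 + (\<phi> - \<psi>) / 2) (max \<phi> \<psi>)
     else min (pi / 2 + (\<phi> - \<psi>) / 2) (pi - max \<phi> \<psi>))"

definition M_theta0 :: "real \<Rightarrow> real \<Rightarrow> real"
  where "M_theta0 \<phi> \<psi> = sin (theta0 \<phi> \<psi> - \<phi>) * sin (theta0 \<phi> \<psi> + \<psi>)"

lemma M_theta0_in:
  assumes "0 \<le> \<phi>" "\<phi> < pi / 2" "0 \<le> \<psi>" "\<psi> < pi / 2"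
  shows "M_theta0 \<phi> \<psi> \<in> {0<..1}"
proof -
  let ?\<theta> = "theta0 \<phi> \<psi>"
  have "0 < ?\<theta> - \<phi>" "?\<theta> - \<phi> < pi" "0 < ?\<theta> + \<psi>" "?\<theta> + \<psi> < pi"
    using assms by (auto simp: theta0_def max_def min_def field_simps)
  then have pos: "0 < sin (?\<theta> - \<phi>)" "0 < sin (?\<theta> + \<psi>)"
    by (auto intro!: sin_gt_zero)
  then have "sin (?\<theta> - \<phi>) * sin (?\<theta> + \<psi>) \<le> 1"
    by (intro mult_le_one) auto
  then show ?thesis
    using pos by (auto simp: M_theta0_def)
qed

end

theory Submission
  imports Defs
begin

text \<open>If \<open>\<A> - \<lambda>\<close> maps \<open>(x, y)\<close> to \<open>(g, h)\<close>, then \<open>C \<subseteq> B\<^sup>*\<close> gives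
  \<open>\<langle>(A - \<lambda>) x, x\<rangle> - cnj \<langle>(D - \<lambda>) y, y\<rangle> = \<langle>g, x\<rangle> - cnj \<langle>h, y\<rangle>\<close>. For \<open>\<lambda> \<notin> \<Sigma>\<close> the numbers
  \<open>z - \<lambda>\<close> with \<open>z \<in> W(A)\<close> and \<open>- cnj (w - \<lambda>)\<close> with \<open>w \<in> W(D)\<close> all lie in one half-plane at
  positive distance from \<open>0\<close>, so that \<open>\<A> - \<lambda>\<close> is bounded below.
  The complement of \<open>\<Sigma>\<close> is starlike about \<open>0\<close>, hence connected, and a
  single point of it with \<open>\<A> - \<lambda>\<close> onto puts all of it into \<open>\<rho>(\<A>)\<close>. Such a point is \<open>0\<close> in
  case (ii'), where the diagonal is a small perturbation of the off-diagonal part, and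
  \<open>r e\<^sup>i\<^sup>\<theta>\<close> with \<open>\<theta>\<close> near \<open>\<theta>\<^sub>0\<close> and \<open>r\<close> large in case (i'), where the roles are exchanged.\<close>

section \<open>Complex inner products\<close>

lemma cinner_scaleC_right: "cinner x (c *\<^sub>C y) = cnj c * cinner x y"
  unfolding cinner_commute[of x] cinner_scaleC_left complex_cnj_mult ..

lemma cinner_zero_left [simp]: "cinner 0 y = 0"
  using cinner_add_left[of 0 0 y] by simp

lemma cinner_zero_right [simp]: "cinner x 0 = 0"
  using cinner_commute[of x 0] by simp

lemma cinner_diff_left: "cinner (x - y) z = cinner x z - cinner y z"
  using cinner_add_left[of "x - y" y z] by simp

lemma cinner_self: "cinner x x = complex_of_real ((norm x)\<^sup>2)"
proof -
  have "Im (cinner x x) = 0"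
    using arg_cong[OF cinner_commute[of x x], of Im] by simp
  moreover have "Re (cinner x x) = (norm x)\<^sup>2"
    by (simp add: inner_eq_Re_cinner[symmetric] power2_norm_eq_inner)
  ultimately show ?thesis by (simp add: complex_eq_iff)
qed

text \<open>The norm is tied to \<open>cinner\<close> only through its real part, so homogeneity
  under complex scalars is read off from the squared norm.\<close>

lemma norm_scaleC: "norm (c *\<^sub>C x) = cmod c * norm x"
proof -
  have "cinner (c *\<^sub>C x) (c *\<^sub>C x) = complex_of_real ((cmod c * norm x)\<^sup>2)"
    unfolding cinner_scaleC_left cinner_scaleC_right cinner_self[of x]
    by (simp add: power_mult_distrib complex_norm_square[unfolded of_real_power] mult.commute)
  then have "(norm (c *\<^sub>C x))\<^sup>2 = (cmod c * norm x)\<^sup>2"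
    unfolding cinner_self of_real_eq_iff .
  then show ?thesis by (simp add: power2_eq_iff_nonneg)
qed

lemma scaleC_zero_left [simp]: "0 *\<^sub>C x = 0"
  using norm_scaleC[of 0 x] by simp

lemma scaleC_minus_left: "(- c) *\<^sub>C x = - (c *\<^sub>C x)"
  using scaleC_add_left[of c "- c" x] by (simp add: eq_neg_iff_add_eq_0 add.commute)

lemma scaleC_one [simp]: "1 *\<^sub>C x = x"
  using scaleR_scaleC[of 1 x] by simp

lemma scaleC_diff_left: "(c - d) *\<^sub>C x = c *\<^sub>C x - d *\<^sub>C x"
  using scaleC_add_left[of "c - d" d x] by simp

lemma scaleC_minus_right: "c *\<^sub>C (- x) = - (c *\<^sub>C x)"
  using scaleC_scaleC[of c "- 1" x] scaleC_minus_left[of 1 x] scaleC_minus_left[of c x] by simp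

lemma scaleC_diff_right: "c *\<^sub>C (x - y) = c *\<^sub>C x - c *\<^sub>C y"
  using scaleC_add_right[of c x "- y"] by (simp add: scaleC_minus_right)

lemma Re_cinner_le: "Re (c * cinner x y) \<le> cmod c * norm x * norm y"
  using norm_cauchy_schwarz[of "c *\<^sub>C x" y]
  by (simp add: inner_eq_Re_cinner cinner_scaleC_left norm_scaleC)

text \<open>A unimodular factor turns the inner product into its modulus, so the bound on real parts
  suffices.\<close>

lemma norm_cinner_le: "cmod (cinner x y) \<le> norm x * norm y"
proof (cases "cinner x y = 0")
  case False
  define c where "c = cnj (sgn (cinner x y))"
  have "c * cinner x y = complex_of_real (cmod (cinner x y))"
    using False complex_norm_square[of "cinner x y"]
    by (simp add: c_def sgn_eq field_simps power2_eq_square)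
  moreover have "cmod c = 1"
    using False by (simp add: c_def norm_sgn)
  ultimately show ?thesis
    using Re_cinner_le[of c x y] by simp
qed auto

section \<open>Linear operators and their resolvent sets\<close>

lemma linear_operatorD:
  assumes "linear_operator T"
  shows "0 \<in> dom T"
    and "\<And>x y. x \<in> dom T \<Longrightarrow> y \<in> dom T \<Longrightarrow> x + y \<in> dom T"
    and "\<And>c x. x \<in> dom T \<Longrightarrow> c *\<^sub>C x \<in> dom T"
    and "\<And>x y. x \<in> dom T \<Longrightarrow> y \<in> dom T \<Longrightarrow> T \<cdot> (x + y) = T \<cdot> x + T \<cdot> y"
    and "\<And>c x. x \<in> dom T \<Longrightarrow> T \<cdot> (c *\<^sub>C x) = c *\<^sub>C (T \<cdot> x)"
  using assms unfolding linear_operator_def csubspace_def by blast+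

lemma linear_operator_diff:
  assumes "linear_operator T" "x \<in> dom T" "y \<in> dom T"
  shows "x - y \<in> dom T" "T \<cdot> (x - y) = T \<cdot> x - T \<cdot> y"
proof -
  have "(- 1) *\<^sub>C y \<in> dom T" "T \<cdot> ((- 1) *\<^sub>C y) = (- 1) *\<^sub>C (T \<cdot> y)"
    using linear_operatorD[OF assms(1)] assms by blast+
  then have "- y \<in> dom T" "T \<cdot> (- y) = - (T \<cdot> y)"
    by (simp_all add: scaleC_minus_left)
  then show "x - y \<in> dom T" "T \<cdot> (x - y) = T \<cdot> x - T \<cdot> y"
    using linear_operatorD(2,4)[OF assms(1), of x "- y"] assms by simp_all
qed

lemma linear_operatorI:
  assumes "0 \<in> dom T"
    and "\<And>x y. x \<in> dom T \<Longrightarrow> y \<in> dom T \<Longrightarrow> x + y \<in> dom T \<and> T \<cdot> (x + y) = T \<cdot> x + T \<cdot> y"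
    and "\<And>c x. x \<in> dom T \<Longrightarrow> c *\<^sub>C x \<in> dom T \<and> T \<cdot> (c *\<^sub>C x) = c *\<^sub>C (T \<cdot> x)"
  shows "linear_operator T"
  using assms unfolding linear_operator_def csubspace_def by blast

section \<open>Shifted and negated operators, bounded inverses\<close>

lemma dom_shift_op [simp]: "dom (shift_op T z) = dom T"
  by (auto simp: shift_op_def dom_def)

lemma shift_op_app: "x \<in> dom T \<Longrightarrow> shift_op T z \<cdot> x = T \<cdot> x - z *\<^sub>C x"
  by (auto simp: shift_op_def)

lemma dom_neg_op [simp]: "dom (neg_op T) = dom T"
  by (auto simp: neg_op_def dom_def)

lemma neg_op_app: "x \<in> dom T \<Longrightarrow> neg_op T \<cdot> x = - (T \<cdot> x)"
  by (auto simp: neg_op_def)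

lemma linear_operator_shift_op:
  assumes "linear_operator T"
  shows "linear_operator (shift_op T z)"
  by (rule linear_operatorI)
    (auto simp: shift_op_app linear_operatorD[OF assms] scaleC_add_right scaleC_diff_right
      scaleC_scaleC mult.commute simp del: domIff)

lemma linear_operator_neg_op:
  assumes "linear_operator T"
  shows "linear_operator (neg_op T)"
  by (rule linear_operatorI)
    (auto simp: neg_op_app linear_operatorD[OF assms] scaleC_minus_right simp del: domIff)

text \<open>Linearity turns the lower bound into injectivity; applied to preimages, the same bound
  gives 1/c as a bound for the inverse.\<close>

lemma boundedly_invertibleI:
  assumes lin: "linear_operator T"
    and c: "0 < c" "\<And>x. x \<in> dom T \<Longrightarrow> c * norm x \<le> norm (T \<cdot> x)"
    and surj: "(\<lambda>x. T \<cdot> x) ` dom T = UNIV"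
  shows "boundedly_invertible T"
proof -
  have inj: "inj_on (\<lambda>x. T \<cdot> x) (dom T)"
  proof (rule inj_onI)
    fix x y assume xy: "x \<in> dom T" "y \<in> dom T" "T \<cdot> x = T \<cdot> y"
    then have "c * norm (x - y) \<le> 0"
      using c(2)[of "x - y"] linear_operator_diff[OF lin xy(1,2)] by simp
    then show "x = y"
      using c(1) by (simp add: mult_le_0_iff)
  qed
  let ?R = "inverse_op T"
  have R: "?R u \<in> dom T" "T \<cdot> ?R u = u" for u
    using the_inv_into_into[OF inj, of u "dom T"] f_the_inv_into_f[OF inj, of u] surj
    by (auto simp: inverse_op_def)
  have R_app: "?R (T \<cdot> x) = x" if "x \<in> dom T" for x
    using the_inv_into_f_f[OF inj that] by (simp add: inverse_op_def)
  have "bounded_linear ?R"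
  proof (rule bounded_linear_intro[where K = "1 / c"])
    fix u v :: 'b and r :: real
    show "?R (u + v) = ?R u + ?R v"
      using R_app[of "?R u + ?R v"] linear_operatorD(2,4)[OF lin R(1)[of u] R(1)[of v]] R by simp
    show "?R (r *\<^sub>R u) = r *\<^sub>R ?R u"
      using R_app[of "complex_of_real r *\<^sub>C ?R u"] linear_operatorD(3,5)[OF lin R(1)[of u]] R
      by (simp add: scaleR_scaleC)
    show "norm (?R u) \<le> norm u * (1 / c)"
      using c(2)[OF R(1)[of u]] c(1) R(2)[of u] by (simp add: field_simps)
  qed
  then show ?thesis
    using inj surj by (simp add: boundedly_invertible_def bij_betw_def)
qed

lemma resolvent_setI:
  assumes "linear_operator T"
    and "0 < c" "\<And>x. x \<in> dom T \<Longrightarrow> c * norm x \<le> norm (T \<cdot> x - z *\<^sub>C x)"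
    and "\<And>u. \<exists>x\<in>dom T. T \<cdot> x - z *\<^sub>C x = u"
  shows "z \<in> resolvent_set T"
proof -
  have "(\<lambda>x. shift_op T z \<cdot> x) ` dom (shift_op T z) = UNIV"
  proof -
    have "u \<in> (\<lambda>x. shift_op T z \<cdot> x) ` dom (shift_op T z)" for u
      using assms(4)[of u] by (metis shift_op_app dom_shift_op image_eqI)
    then show ?thesis by blast
  qed
  then show ?thesis
    using boundedly_invertibleI[OF linear_operator_shift_op[OF assms(1)] assms(2)] assms(3)
    by (simp add: resolvent_set_def shift_op_app del: domIff)
qed

lemma boundedly_invertible_surj:
  assumes "boundedly_invertible T"
  obtains x where "x \<in> dom T" "T \<cdot> x = u"
proof -
  have "u \<in> (\<lambda>x. T \<cdot> x) ` dom T"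
    using assms by (simp add: boundedly_invertible_def bij_betw_def)
  then show ?thesis using that by (elim imageE) simp
qed

lemma resolvent_set_surj:
  assumes "z \<in> resolvent_set T"
  shows "\<exists>x\<in>dom T. T \<cdot> x - z *\<^sub>C x = u"
proof -
  have "boundedly_invertible (shift_op T z)"
    using assms by (simp add: resolvent_set_def)
  then obtain x where "x \<in> dom T" "shift_op T z \<cdot> x = u"
    by (rule boundedly_invertible_surj[of _ u]) simp
  then show ?thesis
    by (intro bexI[of _ x]) (simp_all only: shift_op_app)
qed

section \<open>Persistence of resolvent points\<close>

text \<open>A Neumann series argument in fixed point form: with \<open>R\<close> the inverse at
  \<mu>, the equation at z reads x = \<open>R (u + (z - \<mu>) *\<^sub>C x)\<close>. The radius is
  the constant of the lower bound itself.\<close>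

lemma ball_subset_resolvent_set:
  fixes T :: "'a::chilbert_space \<rightharpoonup> 'a"
  assumes lin: "linear_operator T" and \<mu>: "\<mu> \<in> resolvent_set T"
    and c: "\<And>x. x \<in> dom T \<Longrightarrow> c * norm x \<le> norm (T \<cdot> x - \<mu> *\<^sub>C x)"
  shows "ball \<mu> c \<subseteq> resolvent_set T"
proof
  fix z assume "z \<in> ball \<mu> c"
  then have d: "cmod (z - \<mu>) < c"
    by (simp add: dist_norm norm_minus_commute)
  have "0 < c"
    using d norm_ge_zero[of "z - \<mu>"] by linarith
  obtain R where R: "R u \<in> dom T" "T \<cdot> R u - \<mu> *\<^sub>C R u = u" for u
    using resolvent_set_surj[OF \<mu>] by metis
  show "z \<in> resolvent_set T"
  proof (rule resolvent_setI[OF lin])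
    show "0 < c - cmod (z - \<mu>)" using d by simp
    fix x assume x: "x \<in> dom T"
    have "norm (T \<cdot> x - \<mu> *\<^sub>C x) \<le> norm (T \<cdot> x - z *\<^sub>C x) + norm ((z - \<mu>) *\<^sub>C x)"
      using norm_triangle_ineq[of "T \<cdot> x - z *\<^sub>C x" "(z - \<mu>) *\<^sub>C x"]
      by (simp add: scaleC_diff_left)
    then show "(c - cmod (z - \<mu>)) * norm x \<le> norm (T \<cdot> x - z *\<^sub>C x)"
      using c[OF x] by (simp add: norm_scaleC algebra_simps)
  next
    fix u
    let ?F = "\<lambda>x. R (u + (z - \<mu>) *\<^sub>C x)"
    have "\<exists>!x. ?F x = x"
    proof (rule banach_fix_type[where c = "cmod (z - \<mu>) / c"], safe)
      show "0 \<le> cmod (z - \<mu>) / c" "cmod (z - \<mu>) / c < 1"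
        using d \<open>0 < c\<close> by simp_all
      show "dist (?F x) (?F y) \<le> cmod (z - \<mu>) / c * dist x y" for x y
      proof -
        \<comment> \<open>The difference of two values solves the equation at \<mu> with right-hand
          side \<open>(z - \<mu>) *\<^sub>C (x - y)\<close>; the lower bound then yields the
          contraction factor.\<close>
        let ?w = "?F x - ?F y"
        have "T \<cdot> ?w - \<mu> *\<^sub>C ?w = (z - \<mu>) *\<^sub>C (x - y)"
          using R(2)[of "u + (z - \<mu>) *\<^sub>C x"] R(2)[of "u + (z - \<mu>) *\<^sub>C y"]
          by (simp add: linear_operator_diff(2)[OF lin R(1) R(1)] scaleC_diff_right algebra_simps)
        then have "c * norm ?w \<le> cmod (z - \<mu>) * norm (x - y)"
          using c[OF linear_operator_diff(1)[OF lin R(1) R(1)],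
              of "u + (z - \<mu>) *\<^sub>C x" "u + (z - \<mu>) *\<^sub>C y"]
          by (simp add: norm_scaleC)
        then show ?thesis
          using \<open>0 < c\<close> by (simp add: dist_norm field_simps)
      qed
    qed
    then obtain x where x: "?F x = x" by blast
    have "x \<in> dom T" "T \<cdot> x - \<mu> *\<^sub>C x = u + (z - \<mu>) *\<^sub>C x"
      using R[of "u + (z - \<mu>) *\<^sub>C x"] unfolding x by blast+
    then show "\<exists>x\<in>dom T. T \<cdot> x - z *\<^sub>C x = u"
      by (auto simp: scaleC_diff_left algebra_simps intro!: bexI[of _ x])
  qed
qed

text \<open>The resolvent points form a relatively clopen subset of U: each of them comes with a
  ball of resolvent points, and the lower bound keeps resolvent points away from any point that is
  not one.\<close>

lemma connected_subset_resolvent_set: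
  fixes T :: "'a::chilbert_space \<rightharpoonup> 'a"
  assumes lin: "linear_operator T" and conn: "connected U"
    and lower: "\<And>z. z \<in> U \<Longrightarrow>
      \<exists>c>0. \<forall>x\<in>dom T. c * norm x \<le> norm (T \<cdot> x - z *\<^sub>C x)"
    and ne: "U \<inter> resolvent_set T \<noteq> {}"
  shows "U \<subseteq> resolvent_set T"
proof -
  let ?V = "U \<inter> resolvent_set T"
  have "openin (top_of_set U) ?V"
    unfolding openin_contains_ball
  proof (intro conjI ballI)
    fix z assume z: "z \<in> ?V"
    then obtain c where c: "c > 0" "\<forall>x\<in>dom T. c * norm x \<le> norm (T \<cdot> x - z *\<^sub>C x)"
      using lower by blast
    then have "ball z c \<subseteq> resolvent_set T"
      using ball_subset_resolvent_set[OF lin] z by blast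
    then show "\<exists>e>0. ball z e \<inter> U \<subseteq> ?V"
      using c(1) by blast
  qed simp
  moreover have "openin (top_of_set U) (U - ?V)"
    unfolding openin_contains_ball
  proof (intro conjI ballI)
    fix z assume z: "z \<in> U - ?V"
    then obtain c where c: "c > 0" "\<forall>x\<in>dom T. c * norm x \<le> norm (T \<cdot> x - z *\<^sub>C x)"
      using lower by blast
    \<comment> \<open>Within c/2 of z the lower bound drops by at most c/2, so a resolvent point
      \<mu> there would have a resolvent ball of radius c/2, and this ball contains z.\<close>
    have "\<mu> \<notin> resolvent_set T" if "\<mu> \<in> ball z (c / 2)" for \<mu>
    proof
      assume \<mu>: "\<mu> \<in> resolvent_set T"
      have d: "cmod (\<mu> - z) < c / 2"
        using that by (simp add: dist_norm norm_minus_commute)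
      have "(c / 2) * norm x \<le> norm (T \<cdot> x - \<mu> *\<^sub>C x)" if x: "x \<in> dom T" for x
      proof -
        have "norm (T \<cdot> x - z *\<^sub>C x) \<le> norm (T \<cdot> x - \<mu> *\<^sub>C x) + norm ((\<mu> - z) *\<^sub>C x)"
          using norm_triangle_ineq[of "T \<cdot> x - \<mu> *\<^sub>C x" "(\<mu> - z) *\<^sub>C x"]
          by (simp add: scaleC_diff_left)
        moreover have "norm ((\<mu> - z) *\<^sub>C x) \<le> c / 2 * norm x"
          using d mult_right_mono[of "cmod (\<mu> - z)" "c / 2" "norm x"] by (simp add: norm_scaleC)
        moreover have "c * norm x \<le> norm (T \<cdot> x - z *\<^sub>C x)"
          using c(2) x by blast
        ultimately show ?thesis by simp
      qed
      then have "ball \<mu> (c / 2) \<subseteq> resolvent_set T"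
        using ball_subset_resolvent_set[OF lin \<mu>] by blast
      moreover have "z \<in> ball \<mu> (c / 2)"
        using that by (simp add: dist_commute)
      ultimately show False using z by blast
    qed
    then show "\<exists>e>0. ball z e \<inter> U \<subseteq> U - ?V"
      using c(1) by (intro exI[of _ "c / 2"]) auto
  qed simp
  ultimately have "?V = {} \<or> ?V = U"
    using conn[unfolded connected_clopen, rule_format, of ?V]
    by (simp add: closedin_def)
  then show ?thesis using ne by blast
qed

section \<open>Perturbed two by two systems\<close>

text \<open>Everything is expressed through g = \<open>G \<cdot> x\<close>: the second row
  determines y, and the first becomes a fixed point equation for g with contraction factor pq. G and
  H can be the diagonal or the off-diagonal entries of a block matrix.\<close>

lemma block_system_solvable:
  fixes G :: "'x::complex_inner \<rightharpoonup> 'u::chilbert_space" and H :: "'y::complex_inner \<rightharpoonup> 'v::complex_inner"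
    and K :: "'x \<rightharpoonup> 'v" and L :: "'y \<rightharpoonup> 'u"
  assumes lin: "linear_operator G" "linear_operator H" "linear_operator K" "linear_operator L"
    and surj: "\<And>g. \<exists>x\<in>dom G. G \<cdot> x = g" "\<And>h. \<exists>y\<in>dom H. H \<cdot> y = h"
    and dom: "dom G \<subseteq> dom K" "dom H \<subseteq> dom L"
    and K: "\<And>x. x \<in> dom G \<Longrightarrow> norm (K \<cdot> x) \<le> p * norm (G \<cdot> x)"
    and L: "\<And>y. y \<in> dom H \<Longrightarrow> norm (L \<cdot> y) \<le> q * norm (H \<cdot> y)"
    and pq: "0 \<le> p" "0 \<le> q" "p * q < 1"
  shows "\<exists>x\<in>dom G. \<exists>y\<in>dom H. G \<cdot> x + L \<cdot> y = u \<and> K \<cdot> x + H \<cdot> y = v"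
proof -
  \<comment> \<open>\<open>R\<close> and \<open>S\<close> are mere right inverses, possibly
    nonlinear. The estimates are therefore applied to differences such as \<open>R g - R g'\<close>,
    which G maps to g - g'.\<close>
  obtain R where R: "R g \<in> dom G" "G \<cdot> R g = g" for g using surj(1) by metis
  obtain S where S: "S h \<in> dom H" "H \<cdot> S h = h" for h using surj(2) by metis
  let ?F = "\<lambda>g. u - L \<cdot> S (v - K \<cdot> R g)"
  have "\<exists>!g. ?F g = g"
  proof (rule banach_fix_type[where c = "p * q"], safe)
    show "0 \<le> p * q" "p * q < 1" using pq by simp_all
    show "dist (?F g) (?F g') \<le> p * q * dist g g'" for g g'
    proof -
      let ?h = "v - K \<cdot> R g" and ?h' = "v - K \<cdot> R g'"
      have y: "S ?h' - S ?h \<in> dom H" "H \<cdot> (S ?h' - S ?h) = ?h' - ?h"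
        using linear_operator_diff[OF lin(2) S(1) S(1), of ?h' ?h] by (simp_all add: S)
      have x: "R g - R g' \<in> dom G" "G \<cdot> (R g - R g') = g - g'"
        using linear_operator_diff[OF lin(1) R(1) R(1), of g g'] by (simp_all add: R)
      have "?F g - ?F g' = L \<cdot> (S ?h' - S ?h)"
        using linear_operator_diff(2)[OF lin(4), of "S ?h'" "S ?h"] S(1) dom(2)
        by (simp add: subset_iff del: domIff)
      also have "norm \<dots> \<le> q * norm (?h' - ?h)"
        using L[OF y(1)] y(2) by simp
      also have "?h' - ?h = K \<cdot> (R g - R g')"
        using linear_operator_diff(2)[OF lin(3), of "R g" "R g'"] R(1) dom(1)
        by (simp add: subset_iff del: domIff)
      also have "q * norm \<dots> \<le> q * (p * norm (g - g'))"
        using K[OF x(1)] x(2) pq(2) by (simp add: mult_left_mono)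
      finally show ?thesis by (simp add: dist_norm mult_ac)
    qed
  qed
  then obtain g where g: "?F g = g" by blast
  show ?thesis
    using R[of g] S[of "v - K \<cdot> R g"] g
    by (intro bexI[of _ "R g"] bexI[of _ "S (v - K \<cdot> R g)"]) (auto simp: algebra_simps)
qed

section \<open>Sectors and numerical ranges\<close>

text \<open>In polar form the inequality becomes sin(\<omega> - a) \<ge> 0 with a = |Arg z|. The
  condition on Re z excludes the negative real axis, which satisfies the inequality when \<omega> =
  0.\<close>

lemma mem_sector_iff:
  assumes "0 \<le> \<omega>" "\<omega> \<le> pi / 2"
  shows "z \<in> sector \<omega> \<longleftrightarrow> 0 \<le> Re z \<and> \<bar>Im z\<bar> * cos \<omega> \<le> Re z * sin \<omega>"
proof (cases "z = 0")
  case True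
  then show ?thesis using assms by (simp add: sector_def Arg_zero)
next
  case False
  define a where "a = \<bar>Arg z\<bar>"
  have a: "0 \<le> a" "a \<le> pi"
    using Arg_bounded[of z] by (auto simp: a_def abs_le_iff)
  have "Re z = cmod z * cos a"
    using False by (simp add: a_def cos_Arg)
  moreover have "\<bar>Im z\<bar> = cmod z * sin a"
  proof -
    have "sin a = \<bar>sin (Arg z)\<bar>"
      using sin_ge_zero[OF a] by (auto simp: a_def abs_if split: if_splits)
    then show ?thesis
      using False by (simp add: sin_Arg)
  qed
  ultimately have "0 \<le> Re z \<and> \<bar>Im z\<bar> * cos \<omega> \<le> Re z * sin \<omega> \<longleftrightarrow>
      0 \<le> cos a \<and> 0 \<le> sin (\<omega> - a)"
    using False by (simp add: sin_diff zero_le_mult_iff mult_ac)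
  also have "\<dots> \<longleftrightarrow> a \<le> \<omega>"
  proof
    assume *: "0 \<le> cos a \<and> 0 \<le> sin (\<omega> - a)"
    have "a \<le> pi / 2"
    proof (rule ccontr)
      assume "\<not> a \<le> pi / 2"
      then have "cos a < cos (pi / 2)"
        using a by (intro cos_monotone_0_pi) auto
      then show False using * by simp
    qed
    show "a \<le> \<omega>"
    proof (rule ccontr)
      assume "\<not> a \<le> \<omega>"
      then have "0 < sin (a - \<omega>)"
        using \<open>a \<le> pi / 2\<close> assms pi_gt_zero by (intro sin_gt_zero) linarith+
      then show False using * by (simp add: sin_diff mult.commute)
    qed
  next
    assume "a \<le> \<omega>"
    then show "0 \<le> cos a \<and> 0 \<le> sin (\<omega> - a)"
      using a assms by (auto intro!: cos_ge_zero sin_ge_zero)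
  qed
  finally show ?thesis by (auto simp: sector_def a_def)
qed

lemma sector_mono: "\<phi> \<le> \<tau> \<Longrightarrow> sector \<phi> \<subseteq> sector \<tau>"
  by (auto simp: sector_def)

lemma sector_add:
  assumes "0 \<le> \<omega>" "\<omega> \<le> pi / 2" "z \<in> sector \<omega>" "w \<in> sector \<omega>"
  shows "z + w \<in> sector \<omega>"
proof -
  have "\<bar>Im (z + w)\<bar> * cos \<omega> \<le> \<bar>Im z\<bar> * cos \<omega> + \<bar>Im w\<bar> * cos \<omega>"
    using abs_triangle_ineq[of "Im z" "Im w"] cos_ge_zero[of \<omega>] assms(1,2)
    by (simp flip: distrib_right add: mult_right_mono)
  then show ?thesis
    using assms(3,4) by (simp add: mem_sector_iff[OF assms(1,2)] distrib_right)
qed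

lemma sector_scale:
  assumes "0 \<le> \<omega>" "\<omega> \<le> pi / 2" "z \<in> sector \<omega>" "0 \<le> r"
  shows "complex_of_real r * z \<in> sector \<omega>"
  using assms(3,4) mult_left_mono[of "\<bar>Im z\<bar> * cos \<omega>" "Re z * sin \<omega>" r]
  by (simp add: mem_sector_iff[OF assms(1,2)] abs_mult mult_ac)

lemma cnj_mem_sector:
  assumes "0 \<le> \<omega>" "\<omega> \<le> pi / 2" "z \<in> sector \<omega>"
  shows "cnj z \<in> sector \<omega>"
  using assms(3) by (simp add: mem_sector_iff[OF assms(1,2)])

text \<open>The conjugate of this unit number is the inner normal to a boundary ray of the sector,
  the upper ray for s = 1 and the lower one for s = -1.\<close>

lemma sector_functional:
  assumes \<omega>: "0 \<le> \<omega>" "\<omega> \<le> pi / 2" and s: "s = 1 \<or> s = - 1"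
  shows "cmod (Complex (sin \<omega>) (s * cos \<omega>)) = 1"
    and "z \<in> sector \<omega> \<Longrightarrow> 0 \<le> Re (Complex (sin \<omega>) (s * cos \<omega>) * z)"
proof -
  show "cmod (Complex (sin \<omega>) (s * cos \<omega>)) = 1"
    using s by (auto simp: cmod_def)
  assume "z \<in> sector \<omega>"
  moreover have "(s * Im z) * cos \<omega> \<le> \<bar>Im z\<bar> * cos \<omega>"
    using s \<omega> cos_ge_zero[of \<omega>] by (intro mult_right_mono) auto
  ultimately show "0 \<le> Re (Complex (sin \<omega>) (s * cos \<omega>) * z)"
    by (simp add: mem_sector_iff[OF \<omega>] mult_ac)
qed

text \<open>A point of the open left half-plane is split off by the imaginary axis; any other point
  outside the sector lies beyond the boundary ray on its own side of the real axis.\<close>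

lemma sector_separation:
  assumes \<omega>: "0 \<le> \<omega>" "\<omega> \<le> pi / 2" and l: "l \<notin> sector \<omega>"
  obtains c where "cmod c = 1" "Re (c * l) < 0" "\<And>z. z \<in> sector \<omega> \<Longrightarrow> 0 \<le> Re (c * z)"
proof (cases "Re l < 0")
  case True
  then show ?thesis
    using that[of 1] by (simp add: mem_sector_iff[OF \<omega>])
next
  case False
  define s :: real where "s = (if Im l \<ge> 0 then 1 else - 1)"
  have s: "s = 1 \<or> s = - 1" "s * Im l = \<bar>Im l\<bar>"
    by (auto simp: s_def)
  have "Re (Complex (sin \<omega>) (s * cos \<omega>) * l) = Re l * sin \<omega> - (s * Im l) * cos \<omega>"
    by (simp add: mult_ac)
  also have "\<dots> < 0"
    using l False unfolding s(2) by (simp add: mem_sector_iff[OF \<omega>])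
  finally show ?thesis
    using that sector_functional[OF \<omega> s(1)] by blast
qed

text \<open>Absolute values fold the two opposite sectors onto one, leaving a condition that is
  invariant under positive scaling.\<close>

lemma mem_double_sector_iff:
  assumes \<omega>: "0 \<le> \<omega>" "\<omega> \<le> pi / 2"
  shows "z \<in> uminus ` sector \<omega> \<union> sector \<omega> \<longleftrightarrow> \<bar>Im z\<bar> * cos \<omega> \<le> \<bar>Re z\<bar> * sin \<omega>"
proof -
  have "z \<in> uminus ` sector \<omega> \<longleftrightarrow> - z \<in> sector \<omega>"
    by (auto simp: image_iff intro!: bexI[of _ "- z"])
  then have "z \<in> uminus ` sector \<omega> \<longleftrightarrow> Re z \<le> 0 \<and> \<bar>Im z\<bar> * cos \<omega> \<le> - Re z * sin \<omega>"
    by (simp add: mem_sector_iff[OF \<omega>])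
  moreover have "- \<bar>Re z\<bar> * sin \<omega> \<le> \<bar>Re z\<bar> * sin \<omega>"
    using sin_ge_zero[of \<omega>] \<omega> by (intro mult_right_mono) auto
  ultimately show ?thesis
    by (auto simp: mem_sector_iff[OF \<omega>] abs_if split: if_splits)
qed

section \<open>Quadratic forms and the numerical range\<close>

text \<open>Normalising x carries conditions on the numerical range, which sees unit vectors only,
  over to the quadratic form on the whole domain.\<close>

lemma numerical_range_Rayleigh:
  assumes lin: "linear_operator T" and x: "x \<in> dom T" "x \<noteq> 0"
  shows "complex_of_real (inverse ((norm x)\<^sup>2)) * cinner (T \<cdot> x) x \<in> numerical_range T"
proof -
  let ?f = "complex_of_real (inverse (norm x)) *\<^sub>C x"
  have "?f \<in> dom T" "norm ?f = 1"
    using x linear_operatorD(3)[OF lin x(1)] by (auto simp: norm_scaleC norm_inverse simp del: domIff of_real_inverse)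
  moreover have "cinner (T \<cdot> ?f) ?f = complex_of_real (inverse ((norm x)\<^sup>2)) * cinner (T \<cdot> x) x"
    using linear_operatorD(5)[OF lin x(1), of "complex_of_real (inverse (norm x))"]
    by (simp add: cinner_scaleC_left cinner_scaleC_right power2_eq_square)
  ultimately show ?thesis
    unfolding numerical_range_def mem_Collect_eq by (intro exI[of _ ?f]) (simp only: simp_thms)
qed

lemma cinner_mem_sector:
  assumes lin: "linear_operator T" and T: "numerical_range T \<subseteq> sector \<omega>"
    and \<omega>: "0 \<le> \<omega>" "\<omega> \<le> pi / 2" and x: "x \<in> dom T"
  shows "cinner (T \<cdot> x) x \<in> sector \<omega>"
proof (cases "x = 0")
  case True
  then show ?thesis by (simp add: mem_sector_iff[OF \<omega>])
next
  case False
  let ?z = "complex_of_real (inverse ((norm x)\<^sup>2)) * cinner (T \<cdot> x) x"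
  have "complex_of_real ((norm x)\<^sup>2) * ?z \<in> sector \<omega>"
    by (intro sector_scale[OF \<omega>] subsetD[OF T numerical_range_Rayleigh[OF lin x False]]) simp
  then show ?thesis using False by (simp flip: mult.assoc)
qed

lemma Re_cinner_ge:
  assumes lin: "linear_operator T" and T: "\<forall>z\<in>numerical_range T. \<alpha> \<le> Re z"
    and x: "x \<in> dom T"
  shows "\<alpha> * (norm x)\<^sup>2 \<le> Re (cinner (T \<cdot> x) x)"
proof (cases "x = 0")
  case False
  then show ?thesis
    using bspec[OF T numerical_range_Rayleigh[OF lin x False]] by (simp add: field_simps)
qed simp

lemma cinner_neg_op:
  assumes "x \<in> dom T"
  shows "cinner (neg_op T \<cdot> x) x = - cinner (T \<cdot> x) x"
  using cinner_diff_left[of 0 "T \<cdot> x" x] by (simp add: neg_op_app[OF assms])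

lemma numerical_range_neg_op: "numerical_range (neg_op T) = uminus ` numerical_range T"
proof -
  have "numerical_range S = (\<lambda>f. cinner (S \<cdot> f) f) ` {f \<in> dom S. norm f = 1}" for S :: "'a \<rightharpoonup> 'a"
    by (auto simp: numerical_range_def simp del: domIff)
  then show ?thesis
    by (simp only: image_image dom_neg_op) (rule image_cong, simp_all only: mem_Collect_eq cinner_neg_op)
qed

text \<open>A functional c separating l from the sector is applied to the pairing of
  \<open>T \<cdot> x - l *\<^sub>C x\<close> with x. The contribution of T is nonnegative, and the
  shift leaves -Re(c l) > 0 as the constant.\<close>

lemma sectorial_lower_bound:
  assumes lin: "linear_operator T" and T: "numerical_range T \<subseteq> sector \<omega>"
    and \<omega>: "0 \<le> \<omega>" "\<omega> \<le> pi / 2" and l: "l \<notin> sector \<omega>"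
  shows "\<exists>k>0. \<forall>x\<in>dom T. k * norm x \<le> norm (T \<cdot> x - l *\<^sub>C x)"
proof -
  obtain c where c: "cmod c = 1" "Re (c * l) < 0" "\<And>z. z \<in> sector \<omega> \<Longrightarrow> 0 \<le> Re (c * z)"
    using sector_separation[OF \<omega> l] by blast
  have "- Re (c * l) * norm x \<le> norm (T \<cdot> x - l *\<^sub>C x)" if x: "x \<in> dom T" for x
  proof (cases "x = 0")
    case False
    have "c * cinner (T \<cdot> x - l *\<^sub>C x) x
        = c * cinner (T \<cdot> x) x - (c * l) * complex_of_real ((norm x)\<^sup>2)"
      by (simp add: cinner_diff_left cinner_scaleC_left cinner_self algebra_simps)
    then have "Re (c * cinner (T \<cdot> x - l *\<^sub>C x) x)
        = Re (c * cinner (T \<cdot> x) x) - Re (c * l) * (norm x)\<^sup>2"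
      by (simp only: minus_complex.sel Re_complex_of_real Im_complex_of_real times_complex.sel)
    then have "- Re (c * l) * (norm x)\<^sup>2 \<le> norm (T \<cdot> x - l *\<^sub>C x) * norm x"
      using c(3)[OF cinner_mem_sector[OF lin T \<omega> x]] Re_cinner_le[of c "T \<cdot> x - l *\<^sub>C x" x]
      unfolding c(1) minus_mult_left[symmetric] by linarith
    then have "(- Re (c * l) * norm x) * norm x \<le> norm (T \<cdot> x - l *\<^sub>C x) * norm x"
      by (simp only: power2_eq_square mult.assoc)
    then show ?thesis
      using False by (simp only: mult_le_cancel_right) simp
  qed simp
  then show ?thesis
    using c(2) by (intro exI[of _ "- Re (c * l)"]) simp
qed

text \<open>The definition supplies a single resolvent point outside the sector. The lower bound
  holds throughout the complement, which is starlike about -1, so the resolvent set spreads over all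
  of it.\<close>

lemma m_sectorial_resolvent_set:
  fixes T :: "'a::chilbert_space \<rightharpoonup> 'a"
  assumes lin: "linear_operator T" and T: "m_sectorial \<omega> T"
  shows "UNIV - sector \<omega> \<subseteq> resolvent_set T"
proof (rule connected_subset_resolvent_set[OF lin])
  have \<omega>: "0 \<le> \<omega>" "\<omega> \<le> pi / 2"
    using T by (auto simp: m_sectorial_def)
  show "\<exists>c>0. \<forall>x\<in>dom T. c * norm x \<le> norm (T \<cdot> x - z *\<^sub>C x)" if "z \<in> UNIV - sector \<omega>" for z
    using sectorial_lower_bound[OF lin _ \<omega>] T that by (auto simp: m_sectorial_def)
  show "(UNIV - sector \<omega>) \<inter> resolvent_set T \<noteq> {}"
    using T by (auto simp: m_sectorial_def)
  have "starlike (UNIV - sector \<omega>)"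
    unfolding starlike_def
  proof (intro bexI[of _ "- 1"] ballI subsetI)
    show "- 1 \<in> UNIV - sector \<omega>"
      by (simp add: mem_sector_iff[OF \<omega>])
    fix z p assume z: "z \<in> UNIV - sector \<omega>" and "p \<in> closed_segment (- 1) z"
    then obtain u where u: "0 \<le> u" "u \<le> 1" "p = (1 - u) *\<^sub>R (- 1) + u *\<^sub>R z"
      by (auto simp: in_segment)
    show "p \<in> UNIV - sector \<omega>"
    proof (rule ccontr)
      assume "p \<notin> UNIV - sector \<omega>"
      then have "p \<in> sector \<omega>" by simp
      \<comment> \<open>Adding 1 - u undoes the shift towards -1: the sector is closed under
        addition, so p in the sector would put u z, and for u > 0 also z, into it. For u = 0 the
        point p is -1.\<close>
      moreover have "complex_of_real (1 - u) \<in> sector \<omega>"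
        using sector_scale[OF \<omega>, of 1 "1 - u"] u sin_ge_zero[of \<omega>] \<omega>
        by (simp add: mem_sector_iff[OF \<omega>])
      ultimately have "p + complex_of_real (1 - u) \<in> sector \<omega>"
        by (rule sector_add[OF \<omega>])
      moreover have "p + complex_of_real (1 - u) = complex_of_real u * z"
        unfolding u(3) by (simp add: scaleR_conv_of_real)
      ultimately have uz: "complex_of_real u * z \<in> sector \<omega>" by simp
      show False
      proof (cases "u = 0")
        case True
        then show False
          using \<open>p \<in> sector \<omega>\<close> unfolding u(3) by (simp add: mem_sector_iff[OF \<omega>])
      next
        case False
        then have "z \<in> sector \<omega>"
          using sector_scale[OF \<omega> uz, of "inverse u"] u(1) False by (simp flip: mult.assoc)
        then show False using z by simp
      qed
    qed
  qed
  then show "connected (UNIV - sector \<omega>)"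
    by (rule starlike_imp_connected)
qed

section \<open>Resolvent estimates for sectorial operators\<close>

text \<open>The angles Arg z and \<zeta> differ by at least |\<zeta>| - \<omega>. The bound
  |\<zeta>| + \<omega> \<le> \<pi> keeps their difference within \<pi>, where the cosine is
  monotone.\<close>

lemma Re_cis_le_sector:
  assumes z: "z \<in> sector \<omega>" and \<zeta>: "\<omega> \<le> \<bar>\<zeta>\<bar>" "\<bar>\<zeta>\<bar> + \<omega> \<le> pi"
  shows "Re (cnj (cis \<zeta>) * z) \<le> cmod z * cos (\<bar>\<zeta>\<bar> - \<omega>)"
proof -
  have "z = complex_of_real (cmod z) * cis (Arg z)"
    using rcis_cmod_Arg[of z] by (simp add: rcis_def)
  then have "cnj (cis \<zeta>) * z = cnj (cis \<zeta>) * (complex_of_real (cmod z) * cis (Arg z))"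
    by simp
  also have "\<dots> = complex_of_real (cmod z) * cis (Arg z - \<zeta>)"
    by (simp add: cis_cnj cis_mult mult.left_commute)
  finally have "Re (cnj (cis \<zeta>) * z) = cmod z * cos \<bar>Arg z - \<zeta>\<bar>"
    by simp
  moreover have "cos \<bar>Arg z - \<zeta>\<bar> \<le> cos (\<bar>\<zeta>\<bar> - \<omega>)"
    using z \<zeta> by (intro cos_monotone_0_pi_le) (auto simp: sector_def)
  ultimately show ?thesis by (simp add: mult_left_mono)
qed

text \<open>The law of cosines: \<open>T \<cdot> x\<close> and the shifted multiple of x form an
  angle with cosine at most m, so the squared norm of their difference is at least (1 - m^2) times
  the square of either length.\<close>

lemma sectorial_resolvent_estimate:
  assumes lin: "linear_operator T" and T: "numerical_range T \<subseteq> sector \<omega>"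
    and \<omega>: "0 \<le> \<omega>" "\<omega> \<le> pi / 2" and x: "x \<in> dom T"
    and \<zeta>: "\<omega> \<le> \<bar>\<zeta>\<bar>" "\<bar>\<zeta>\<bar> + \<omega> \<le> pi" and r: "0 \<le> r"
  defines "w \<equiv> norm (T \<cdot> x - (complex_of_real r * cis \<zeta>) *\<^sub>C x)"
  shows "sin (\<bar>\<zeta>\<bar> - \<omega>) * norm (T \<cdot> x) \<le> w" "sin (\<bar>\<zeta>\<bar> - \<omega>) * (r * norm x) \<le> w"
proof -
  let ?l = "complex_of_real r * cis \<zeta>" and ?s = "sin (\<bar>\<zeta>\<bar> - \<omega>)"
  \<comment> \<open>The cosine is cut off at 0 because the Cauchy-Schwarz bound for the modulus of
    the pairing survives multiplication by nonnegative factors only.\<close>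
  define m where "m = max 0 (cos (\<bar>\<zeta>\<bar> - \<omega>))"
  let ?t = "norm (T \<cdot> x)" and ?v = "r * norm x"
  have m: "?s\<^sup>2 \<le> 1 - m\<^sup>2"
  proof -
    have "m\<^sup>2 \<le> (cos (\<bar>\<zeta>\<bar> - \<omega>))\<^sup>2" by (simp add: m_def max_def)
    then show ?thesis using sin_cos_squared_add[of "\<bar>\<zeta>\<bar> - \<omega>"] by linarith
  qed
  have "Re (cnj (cis \<zeta>) * cinner (T \<cdot> x) x) \<le> cmod (cinner (T \<cdot> x) x) * cos (\<bar>\<zeta>\<bar> - \<omega>)"
    using Re_cis_le_sector[OF cinner_mem_sector[OF lin T \<omega> x] \<zeta>] .
  also have "\<dots> \<le> cmod (cinner (T \<cdot> x) x) * m"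
    by (simp add: m_def mult_left_mono)
  also have "\<dots> \<le> (?t * norm x) * m"
    using norm_cinner_le by (intro mult_right_mono) (auto simp: m_def)
  finally have "r * Re (cnj (cis \<zeta>) * cinner (T \<cdot> x) x) \<le> r * ((?t * norm x) * m)"
    using r by (intro mult_left_mono)
  also have "r * Re (cnj (cis \<zeta>) * cinner (T \<cdot> x) x) = inner (T \<cdot> x) (?l *\<^sub>C x)"
    by (simp add: inner_eq_Re_cinner cinner_scaleC_right algebra_simps)
  also have "r * ((?t * norm x) * m) = m * ?t * ?v"
    by (simp only: mult_ac)
  finally have "inner (T \<cdot> x) (?l *\<^sub>C x) \<le> m * ?t * ?v" .
  moreover have "w\<^sup>2 = ?t\<^sup>2 + ?v\<^sup>2 - 2 * inner (T \<cdot> x) (?l *\<^sub>C x)"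
  proof -
    have "norm (?l *\<^sub>C x) = ?v"
      using r by (simp add: norm_scaleC norm_mult)
    then show ?thesis
      using dot_norm_neg[of "T \<cdot> x" "?l *\<^sub>C x"] by (simp add: w_def)
  qed
  ultimately have w: "?t\<^sup>2 + ?v\<^sup>2 - 2 * m * ?t * ?v \<le> w\<^sup>2"
    by linarith
  have "(?s * ?t)\<^sup>2 \<le> (1 - m\<^sup>2) * ?t\<^sup>2"
    unfolding power_mult_distrib using m by (intro mult_right_mono) auto
  \<comment> \<open>Completing the square, with t and v the two lengths: t^2 + v^2 - 2mtv = (1 -
    m^2) t^2 + (v - mt)^2.\<close>
  also have "\<dots> \<le> w\<^sup>2"
    using w zero_le_power2[of "?v - m * ?t"] by (simp add: power2_eq_square algebra_simps)
  finally show "?s * ?t \<le> w"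
    by (rule power2_le_imp_le) (simp add: w_def)
  have "(?s * ?v)\<^sup>2 \<le> (1 - m\<^sup>2) * ?v\<^sup>2"
    unfolding power_mult_distrib[of ?s] using m by (intro mult_right_mono) auto
  also have "\<dots> \<le> w\<^sup>2"
    using w zero_le_power2[of "?t - m * ?v"] by (simp add: power2_eq_square algebra_simps)
  finally show "?s * ?v \<le> w"
    by (rule power2_le_imp_le) (simp add: w_def)
qed

text \<open>The estimate for r times the norm of x attaches a factor 1/r to a, so far out on the ray
  only b / sin(|\<zeta>| - \<omega>) remains.\<close>

lemma rel_bounded_resolvent_estimate:
  assumes lin: "linear_operator T" and T: "numerical_range T \<subseteq> sector \<omega>"
    and \<omega>: "0 \<le> \<omega>" "\<omega> \<le> pi / 2" and x: "x \<in> dom T"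
    and \<zeta>: "\<omega> < \<bar>\<zeta>\<bar>" "\<bar>\<zeta>\<bar> + \<omega> < pi" and r: "0 < r"
    and S: "rel_bound_consts S T a b"
  shows "norm (S \<cdot> x) \<le>
    (a / r + b) / sin (\<bar>\<zeta>\<bar> - \<omega>) * norm (T \<cdot> x - (complex_of_real r * cis \<zeta>) *\<^sub>C x)"
proof -
  let ?w = "norm (T \<cdot> x - (complex_of_real r * cis \<zeta>) *\<^sub>C x)" and ?s = "sin (\<bar>\<zeta>\<bar> - \<omega>)"
  have s: "0 < ?s" using \<omega> \<zeta> by (intro sin_gt_zero) auto
  have est: "?s * norm (T \<cdot> x) \<le> ?w" "?s * (r * norm x) \<le> ?w"
    using sectorial_resolvent_estimate[OF lin T \<omega> x, of \<zeta> r] \<zeta> r by auto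
  have "norm (S \<cdot> x) \<le> a * norm x + b * norm (T \<cdot> x)"
    using S x by (auto simp: rel_bound_consts_def simp del: domIff)
  also have "a * norm x + b * norm (T \<cdot> x) \<le> a * (?w / (?s * r)) + b * (?w / ?s)"
    using est s r S
    by (intro add_mono mult_left_mono) (auto simp: rel_bound_consts_def field_simps)
  also have "\<dots> = (a / r + b) / ?s * ?w"
    using s r by (simp add: field_simps)
  finally show ?thesis .
qed

text \<open>The relative bound is an infimum that need not be attained, so admissible constants are
  found only below each larger number.\<close>

lemma rel_bound_consts_near_relative_bound:
  assumes "rel_bounded S T" "relative_bound S T < b"
  obtains a b' where "rel_bound_consts S T a b'" "b' < b"
proof -
  have "{b. \<exists>a. rel_bound_consts S T a b} \<noteq> {}"
    using assms(1) by (auto simp: rel_bounded_def)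
  then show ?thesis
    using cInf_lessD[OF _ assms(2)[unfolded relative_bound_def]] that by blast
qed

section \<open>Block operator matrices\<close>

lemma dom_block_op: "dom (block_op A B C D) = (dom A \<inter> dom C) \<times> (dom B \<inter> dom D)"
  by (auto simp: block_op_def dom_def split: if_splits)

lemma block_op_app:
  assumes "x \<in> dom A \<inter> dom C" "y \<in> dom B \<inter> dom D"
  shows "block_op A B C D \<cdot> (x, y) = (A \<cdot> x + B \<cdot> y, C \<cdot> x + D \<cdot> y)"
  unfolding block_op_def case_prod_conv if_P[OF conjI[OF assms]] option.sel ..

lemma linear_operator_block_op:
  assumes "linear_operator A" "linear_operator B" "linear_operator C" "linear_operator D"
  shows "linear_operator (block_op A B C D)"
proof (rule linear_operatorI)
  let ?T = "block_op A B C D"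
  note lin = assms[THEN linear_operatorD(1)] assms[THEN linear_operatorD(2)]
    assms[THEN linear_operatorD(3)]
    assms[THEN linear_operatorD(4)] assms[THEN linear_operatorD(5)]
  show "0 \<in> dom ?T"
    unfolding dom_block_op zero_prod_def using lin by blast
  fix f assume "f \<in> dom ?T"
  then obtain x y where f: "f = (x, y)" "x \<in> dom A \<inter> dom C" "y \<in> dom B \<inter> dom D"
    unfolding dom_block_op by blast
  {
    fix g assume "g \<in> dom ?T"
    then obtain x' y' where g: "g = (x', y')" "x' \<in> dom A \<inter> dom C" "y' \<in> dom B \<inter> dom D"
      unfolding dom_block_op by blast
    have s: "x + x' \<in> dom A \<inter> dom C" "y + y' \<in> dom B \<inter> dom D"
      using f g lin by blast+
    have "f + g \<in> dom ?T"
      using s by (simp add: dom_block_op f g del: domIff)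
    moreover have "?T \<cdot> (f + g) = ?T \<cdot> f + ?T \<cdot> g"
      using f(2,3) g(2,3) unfolding f(1) g(1) add_Pair block_op_app[OF s]
        block_op_app[OF f(2,3)] block_op_app[OF g(2,3)]
      by (simp add: lin del: domIff)
    ultimately show "f + g \<in> dom ?T \<and> ?T \<cdot> (f + g) = ?T \<cdot> f + ?T \<cdot> g" ..
  }
  fix c
  have s: "c *\<^sub>C x \<in> dom A \<inter> dom C" "c *\<^sub>C y \<in> dom B \<inter> dom D"
    using f lin by blast+
  have cf: "c *\<^sub>C f = (c *\<^sub>C x, c *\<^sub>C y)"
    by (simp add: f scaleC_prod_def)
  have "c *\<^sub>C f \<in> dom ?T"
    using s by (simp add: dom_block_op cf del: domIff)
  moreover have "?T \<cdot> (c *\<^sub>C f) = c *\<^sub>C (?T \<cdot> f)"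
    using f(2,3) unfolding cf block_op_app[OF s] unfolding f(1) block_op_app[OF f(2,3)]
    by (simp add: lin scaleC_prod_def scaleC_add_right del: domIff)
  ultimately show "c *\<^sub>C f \<in> dom ?T \<and> ?T \<cdot> (c *\<^sub>C f) = c *\<^sub>C (?T \<cdot> f)" ..
qed

lemma cinner_adjoint_restriction:
  assumes "densely_defined B" "C \<subseteq>\<^sub>m adjoint_op B" "x \<in> dom C" "y \<in> dom B"
  shows "cinner (B \<cdot> y) x = cinner y (C \<cdot> x)"
proof -
  have "adjoint_op B x = Some (C \<cdot> x)"
    using assms(2,3) unfolding map_le_def dom_def by fastforce
  then show ?thesis
    using assms(4) unfolding adjoint_op_eq_Some_iff[OF assms(1)] by blast
qed

text \<open>Subtracting the conjugate of the second row from the first cancels the off-diagonal terms,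
  since \<open>C\<close> is contained in the adjoint of \<open>B\<close>.\<close>

lemma block_op_lower_bound:
  fixes k :: real and l :: complex
  assumes B: "densely_defined B" and C: "C \<subseteq>\<^sub>m adjoint_op B"
    and c: "cmod c = 1"
    and A: "\<And>x. x \<in> dom A \<Longrightarrow>
      k * (norm x)\<^sup>2 \<le> Re (c * (cinner (A \<cdot> x) x - l * (norm x)\<^sup>2))"
    and D: "\<And>y. y \<in> dom D \<Longrightarrow>
      k * (norm y)\<^sup>2 \<le> Re (c * (cnj l * (norm y)\<^sup>2 - cnj (cinner (D \<cdot> y) y)))"
    and f: "f \<in> dom (block_op A B C D)"
  shows "k / 2 * norm f \<le> norm (block_op A B C D \<cdot> f - l *\<^sub>C f)"
proof (cases "f = 0")
  case False
  obtain x y where xy: "f = (x, y)" "x \<in> dom A \<inter> dom C" "y \<in> dom B \<inter> dom D"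
    using f unfolding dom_block_op by blast
  define g where "g = block_op A B C D \<cdot> f - l *\<^sub>C f"
  let ?g = "A \<cdot> x + B \<cdot> y - l *\<^sub>C x" and ?h = "C \<cdot> x + D \<cdot> y - l *\<^sub>C y"
  have g: "g = (?g, ?h)"
    unfolding g_def xy(1) block_op_app[OF xy(2,3)] by (simp add: scaleC_prod_def)
  have "cinner (B \<cdot> y) x = cnj (cinner (C \<cdot> x) y)"
    using cinner_adjoint_restriction[OF B C] xy by (metis IntD1 IntD2 cinner_commute)
  then have "cinner ?g x - cnj (cinner ?h y)
      = (cinner (A \<cdot> x) x - l * (norm x)\<^sup>2) + (cnj l * (norm y)\<^sup>2 - cnj (cinner (D \<cdot> y) y))"
    by (simp add: cinner_diff_left cinner_add_left cinner_scaleC_left cinner_self)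
  then have "Re (c * (cinner ?g x - cnj (cinner ?h y)))
      = Re (c * (cinner (A \<cdot> x) x - l * (norm x)\<^sup>2))
        + Re (c * (cnj l * (norm y)\<^sup>2 - cnj (cinner (D \<cdot> y) y)))"
    by (simp only: distrib_left plus_complex.sel)
  moreover have "k * (norm f)\<^sup>2 = k * (norm x)\<^sup>2 + k * (norm y)\<^sup>2"
    by (simp add: xy(1) norm_Pair distrib_left)
  ultimately have "k * (norm f)\<^sup>2 \<le> Re (c * (cinner ?g x - cnj (cinner ?h y)))"
    using A[of x] D[of y] xy(2,3) by auto
  also have "\<dots> \<le> cmod (c * (cinner ?g x - cnj (cinner ?h y)))"
    by (rule complex_Re_le_cmod)
  also have "\<dots> \<le> cmod (cinner ?g x) + cmod (cinner ?h y)"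
    using norm_triangle_ineq4[of "cinner ?g x" "cnj (cinner ?h y)"] by (simp add: norm_mult c)
  \<comment> \<open>Components are bounded by the full norms; the two equal terms account for the
    k/2 in the conclusion.\<close>
  also have "\<dots> \<le> norm g * norm f + norm g * norm f"
  proof (rule add_mono)
    show "cmod (cinner ?g x) \<le> norm g * norm f"
      using norm_fst_le[of ?g ?h] norm_fst_le[of x y] unfolding g xy(1)
      by (intro order_trans[OF norm_cinner_le] mult_mono) auto
    show "cmod (cinner ?h y) \<le> norm g * norm f"
      using norm_snd_le[of ?h ?g] norm_snd_le[of y x] unfolding g xy(1)
      by (intro order_trans[OF norm_cinner_le] mult_mono) auto
  qed
  finally have "(k / 2 * norm f) * norm f \<le> norm g * norm f"
    by (simp add: power2_eq_square mult_ac)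
  then show ?thesis
    using False by (simp add: g_def)
qed simp

section \<open>The angle \<open>\<theta>\<^sub>0\<close>\<close>

text \<open>The angle \<open>\<theta>\<^sub>0\<close> itself may lie on the boundary of the double sector; it is moved slightly
  towards \<open>\<pi>/2\<close>.\<close>

lemma angle_near_theta0:
  assumes "0 \<le> \<phi>" "\<phi> < pi / 2" "0 \<le> \<psi>" "\<psi> < pi / 2" and m: "m < M_theta0 \<phi> \<psi>"
  obtains \<theta> where "max \<phi> \<psi> < \<theta>" "\<theta> < pi - max \<phi> \<psi>" "m < sin (\<theta> - \<phi>) * sin (\<theta> + \<psi>)"
proof -
  let ?\<theta>0 = "theta0 \<phi> \<psi>" and ?\<tau> = "max \<phi> \<psi>"
  \<comment> \<open>The angle moves linearly from \<open>theta0 \<phi> \<psi>\<close> at t = 0 to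
    \<pi>/2 at t = 1. As \<phi> and \<psi> are below \<pi>/2, each t in (0, 1) lands strictly
    between the two bounds, and continuity keeps the product of sines above m for small t.\<close>
  define \<theta> where "\<theta> t = (1 - t) * ?\<theta>0 + t * (pi / 2)" for t
  have "((\<lambda>t. sin (\<theta> t - \<phi>) * sin (\<theta> t + \<psi>)) \<longlongrightarrow> sin (\<theta> 0 - \<phi>) * sin (\<theta> 0 + \<psi>)) (at_right 0)"
    unfolding \<theta>_def by (intro tendsto_intros)
  moreover have "m < sin (\<theta> 0 - \<phi>) * sin (\<theta> 0 + \<psi>)"
    using m by (simp add: \<theta>_def M_theta0_def)
  ultimately have "\<forall>\<^sub>F t in at_right 0. m < sin (\<theta> t - \<phi>) * sin (\<theta> t + \<psi>)"
    by (rule order_tendstoD(1))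
  moreover have "\<forall>\<^sub>F t in at_right (0 :: real). 0 < t \<and> t < 1"
    by (rule eventually_at_rightI[of 0 1]) auto
  ultimately have "\<forall>\<^sub>F t in at_right 0. m < sin (\<theta> t - \<phi>) * sin (\<theta> t + \<psi>) \<and> 0 < t \<and> t < 1"
    by (rule eventually_conj)
  then obtain t where t: "m < sin (\<theta> t - \<phi>) * sin (\<theta> t + \<psi>)" "0 < t" "t < 1"
    using eventually_happens[of _ "at_right (0 :: real)"] by auto
  have \<theta>0: "?\<tau> \<le> ?\<theta>0" "?\<theta>0 \<le> pi - ?\<tau>"
    using assms by (auto simp: theta0_def max_def min_def field_simps)
  have "(1 - t) * ?\<tau> + t * ?\<tau> < \<theta> t"
    unfolding \<theta>_def using t \<theta>0 assms by (intro add_le_less_mono mult_left_mono mult_strict_left_mono) auto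
  moreover have "\<theta> t < (1 - t) * (pi - ?\<tau>) + t * (pi - ?\<tau>)"
    unfolding \<theta>_def using t \<theta>0 assms by (intro add_le_less_mono mult_left_mono mult_strict_left_mono) auto
  ultimately have "?\<tau> < \<theta> t" "\<theta> t < pi - ?\<tau>"
    by (simp_all flip: distrib_right)
  then show ?thesis using that t(1) by blast
qed

section \<open>The spectral enclosure\<close>

text \<open>The hypotheses shared by both cases. They already give the lower bound and the
  connectedness of the complement of \<Sigma>.\<close>

locale block_matrix =
  fixes A :: "'a::chilbert_space \<rightharpoonup> 'a"
    and B :: "'b::chilbert_space \<rightharpoonup> 'a"
    and C :: "'a \<rightharpoonup> 'b"
    and D :: "'b \<rightharpoonup> 'b"
    and \<alpha> \<delta> \<phi> \<psi> :: real
  assumes linear: "linear_operator A" "linear_operator B" "linear_operator C" "linear_operator D"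
    and dense_B: "densely_defined B"
    and C_sub: "C \<subseteq>\<^sub>m adjoint_op B"
    and phi: "0 \<le> \<phi>" "\<phi> \<le> pi / 2"
    and psi: "0 \<le> \<psi>" "\<psi> \<le> pi / 2"
    and signs: "\<delta> < 0" "0 < \<alpha>"
    and Re_D: "\<forall>z\<in>numerical_range D. Re z \<le> \<delta>"
    and Re_A: "\<forall>z\<in>numerical_range A. \<alpha> \<le> Re z"
    and sector_A: "numerical_range A \<subseteq> sector \<phi>"
    and sector_D: "numerical_range D \<subseteq> uminus ` sector \<psi>"
begin

abbreviation "\<tau> \<equiv> max \<phi> \<psi>"

text \<open>This is the complement of \<Sigma>, see \<open>gap_eq\<close>, in a form that makes its
  behaviour under scaling visible.\<close>

definition gap :: "complex set"
  where "gap = {z. \<bar>Re z\<bar> * sin \<tau> < \<bar>Im z\<bar> * cos \<tau> \<or> \<delta> < Re z \<and> Re z < \<alpha>}"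

lemma tau: "0 \<le> \<tau>" "\<tau> \<le> pi / 2"
  using phi psi by auto

lemma sin_tau: "0 \<le> sin \<tau>"
  using tau by (intro sin_ge_zero) linarith+

lemma gap_eq: "gap = UNIV - (uminus ` sector \<tau> \<union> sector \<tau>) \<inter> {z. Re z \<notin> {\<delta><..<\<alpha>}}"
  unfolding set_eq_iff Diff_iff Int_iff mem_double_sector_iff[OF tau] by (auto simp: gap_def)

text \<open>The strip is convex and contains 0, and the other condition is invariant under positive
  scaling; the end point 0 of each segment lies in the strip.\<close>

lemma connected_gap: "connected gap"
proof (rule starlike_imp_connected)
  show "starlike gap"
    unfolding starlike_def
  proof (intro bexI[of _ 0] ballI subsetI)
    show "0 \<in> gap" using signs by (simp add: gap_def)
    fix z p assume z: "z \<in> gap" and "p \<in> closed_segment 0 z"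
    then obtain u where u: "0 \<le> u" "u \<le> 1" "p = u *\<^sub>R z"
      by (auto simp: in_segment)
    show "p \<in> gap"
    proof (cases "u = 0")
      case True
      then show ?thesis using signs by (simp add: gap_def u)
    next
      case False
      then have "0 < u" using u by simp
      show ?thesis
      proof (cases "\<delta> < Re z \<and> Re z < \<alpha>")
        case True
        have "min 0 (Re z) \<le> u * Re z"
          using u mult_right_mono_neg[of u 1 "Re z"] mult_nonneg_nonneg[of u "Re z"]
          by (cases "0 \<le> Re z") auto
        moreover have "u * Re z \<le> max 0 (Re z)"
          using u mult_right_mono[of u 1 "Re z"] mult_nonneg_nonpos[of u "Re z"]
          by (cases "0 \<le> Re z") auto
        ultimately have "\<delta> < u * Re z" "u * Re z < \<alpha>"
          using True signs by linarith+
        then show ?thesis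
          by (simp add: gap_def u(3))
      next
        case False
        then have "u * (\<bar>Re z\<bar> * sin \<tau>) < u * (\<bar>Im z\<bar> * cos \<tau>)"
          using z \<open>0 < u\<close> by (auto simp: gap_def)
        then show ?thesis
          using \<open>0 < u\<close> by (simp add: gap_def u(3) abs_mult mult.assoc)
      qed
    qed
  qed
qed

lemma neg_D: "linear_operator (neg_op D)" "numerical_range (neg_op D) \<subseteq> sector \<psi>"
  using linear_operator_neg_op[OF linear(4)] sector_D
  by (auto simp: numerical_range_neg_op)

text \<open>A single unimodular c has to serve both rows, making the quadratic forms of A - l and of
  cnj l minus the conjugated form of D positive together.\<close>

lemma lower_bound:
  assumes "l \<in> gap"
  shows "\<exists>k>0. \<forall>f\<in>dom (block_op A B C D). k * norm f \<le> norm (block_op A B C D \<cdot> f - l *\<^sub>C f)"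
proof -
  have "\<exists>c k. cmod c = 1 \<and> 0 < k
    \<and> (\<forall>x\<in>dom A. k * (norm x)\<^sup>2 \<le> Re (c * (cinner (A \<cdot> x) x - l * (norm x)\<^sup>2)))
    \<and> (\<forall>y\<in>dom D. k * (norm y)\<^sup>2 \<le> Re (c * (cnj l * (norm y)\<^sup>2 - cnj (cinner (D \<cdot> y) y))))"
  proof (cases "\<delta> < Re l \<and> Re l < \<alpha>")
    case True
    \<comment> \<open>In the strip real parts suffice, that is c = 1, and k is the distance from Re
      l to the nearer end of the interval.\<close>
    define k where "k = min (\<alpha> - Re l) (Re l - \<delta>)"
    have "k * (norm x)\<^sup>2 \<le> Re (1 * (cinner (A \<cdot> x) x - l * (norm x)\<^sup>2))" if x: "x \<in> dom A" for x
    proof -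
      have "k * (norm x)\<^sup>2 \<le> (\<alpha> - Re l) * (norm x)\<^sup>2"
        by (intro mult_right_mono) (auto simp: k_def)
      then show ?thesis
        using Re_cinner_ge[OF linear(1) Re_A x] by (simp add: algebra_simps flip: of_real_power)
    qed
    moreover have "k * (norm y)\<^sup>2 \<le> Re (1 * (cnj l * (norm y)\<^sup>2 - cnj (cinner (D \<cdot> y) y)))"
      if y: "y \<in> dom D" for y
    proof -
      have "k * (norm y)\<^sup>2 \<le> (Re l - \<delta>) * (norm y)\<^sup>2"
        by (intro mult_right_mono) (auto simp: k_def)
      moreover have "\<forall>z\<in>numerical_range (neg_op D). - \<delta> \<le> Re z"
        using Re_D by (simp add: numerical_range_neg_op)
      then have "- \<delta> * (norm y)\<^sup>2 \<le> - Re (cinner (D \<cdot> y) y)"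
        using Re_cinner_ge[OF neg_D(1), of "- \<delta>" y] y by (simp add: cinner_neg_op del: domIff)
      ultimately show ?thesis
        by (simp add: algebra_simps flip: of_real_power)
    qed
    moreover have "0 < k" using True by (simp add: k_def)
    ultimately show ?thesis by (intro exI[of _ 1] exI[of _ k]) (simp only: norm_one ball_simps, blast)
  next
    case False
    \<comment> \<open>Off the double sector k is the distance from l to its boundary rays, and
      \<open>?c\<close> is the normal selected by the sign of Im l.\<close>
    define k where "k = \<bar>Im l\<bar> * cos \<tau> - \<bar>Re l\<bar> * sin \<tau>"
    define s :: real where "s = (if Im l \<ge> 0 then 1 else - 1)"
    have s: "s = 1 \<or> s = - 1" "s * Im l = \<bar>Im l\<bar>"
      by (auto simp: s_def)
    let ?c = "Complex (sin \<tau>) (s * cos \<tau>)"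
    note c = sector_functional[OF tau s(1)]
    have "0 < k" using assms False by (simp add: gap_def k_def)
    \<comment> \<open>The numbers -l and cnj l have equal imaginary and opposite real parts, so one
      bound on |Re l| sin \<tau> handles both.\<close>
    have "\<bar>Re l * sin \<tau>\<bar> = \<bar>Re l\<bar> * sin \<tau>"
      using sin_tau by (simp add: abs_mult)
    then have "k \<le> - (Re l * sin \<tau>) + (s * Im l) * cos \<tau>" "k \<le> Re l * sin \<tau> + (s * Im l) * cos \<tau>"
      unfolding k_def s(2) by linarith+
    then have k: "k \<le> Re (?c * - l)" "k \<le> Re (?c * cnj l)"
      by (simp_all add: mult_ac)
    have split: "k * r \<le> Re (?c * (z + w * complex_of_real r))"
      if "z \<in> sector \<tau>" "k \<le> Re (?c * w)" "0 \<le> r" for z w r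
    proof -
      have "Re (?c * (z + w * complex_of_real r)) = Re (?c * z) + Re (?c * w) * r"
        by (simp add: algebra_simps)
      then show ?thesis
        using c(2)[OF that(1)] mult_right_mono[OF that(2,3)] by linarith
    qed
    have "k * (norm x)\<^sup>2 \<le> Re (?c * (cinner (A \<cdot> x) x - l * (norm x)\<^sup>2))" if "x \<in> dom A" for x
      using split[OF _ k(1), of "cinner (A \<cdot> x) x" "(norm x)\<^sup>2"]
        cinner_mem_sector[OF linear(1) sector_A phi that] sector_mono[of \<phi> \<tau>]
      by (simp add: subset_iff)
    moreover have "k * (norm y)\<^sup>2 \<le> Re (?c * (cnj l * (norm y)\<^sup>2 - cnj (cinner (D \<cdot> y) y)))"
      if "y \<in> dom D" for y
    proof -
      have "- cnj (cinner (D \<cdot> y) y) \<in> sector \<psi>"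
        using cnj_mem_sector[OF psi cinner_mem_sector[OF neg_D psi, of y]] that
        by (simp add: cinner_neg_op del: domIff)
      then have "- cnj (cinner (D \<cdot> y) y) \<in> sector \<tau>"
        using sector_mono[of \<psi> \<tau>] by auto
      then show ?thesis
        using split[OF _ k(2), of "- cnj (cinner (D \<cdot> y) y)" "(norm y)\<^sup>2"] by simp
    qed
    ultimately show ?thesis
      using c(1) \<open>0 < k\<close> by blast
  qed
  then obtain c k where "cmod c = 1" "0 < k"
    "\<And>x. x \<in> dom A \<Longrightarrow> k * (norm x)\<^sup>2 \<le> Re (c * (cinner (A \<cdot> x) x - l * (norm x)\<^sup>2))"
    "\<And>y. y \<in> dom D \<Longrightarrow> k * (norm y)\<^sup>2 \<le> Re (c * (cnj l * (norm y)\<^sup>2 - cnj (cinner (D \<cdot> y) y)))"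
    by blast
  then show ?thesis
    using block_op_lower_bound[OF dense_B C_sub, of c A k l D]
    by (intro exI[of _ "k / 2"] conjI ballI) simp_all
qed

text \<open>Leaves to each case only solvability at one point: the lower bound makes it a resolvent
  point, and connectedness does the rest.\<close>

lemma gap_subset_resolvent_set:
  assumes "l \<in> gap" and "\<And>g. \<exists>f\<in>dom (block_op A B C D). block_op A B C D \<cdot> f - l *\<^sub>C f = g"
  shows "gap \<subseteq> resolvent_set (block_op A B C D)"
proof -
  note lin = linear_operator_block_op[OF linear]
  obtain k where "0 < k"
    "\<And>f. f \<in> dom (block_op A B C D) \<Longrightarrow> k * norm f \<le> norm (block_op A B C D \<cdot> f - l *\<^sub>C f)"
    using lower_bound[OF assms(1)] by blast
  then have "l \<in> resolvent_set (block_op A B C D)"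
    using resolvent_setI[OF lin _ _ assms(2)] by blast
  then show ?thesis
    using connected_subset_resolvent_set[OF lin connected_gap lower_bound] assms(1) by blast
qed

section \<open>The case of m-sectorial diagonal entries\<close>

text \<open>On a ray in \<open>gap\<close> the shifted diagonal entries are onto, with C and B as
  perturbations of sizes \<open>p r\<close> and \<open>q r\<close>. For large r the product
  approaches \<open>b\<^sub>A * b\<^sub>D / (sin (\<theta> - \<phi>) * sin (\<theta> +
  \<psi>))\<close>, which is below 1 for constants close to the relative bounds.\<close>

lemma gap_subset_resolvent_set_sectorial:
  assumes A: "m_sectorial \<phi> A" and D: "m_sectorial \<psi> (neg_op D)"
    and rel: "rel_bounded C A" "rel_bounded B D"
    and small: "relative_bound C A * relative_bound B D < M_theta0 \<phi> \<psi>"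
  shows "gap \<subseteq> resolvent_set (block_op A B C D)"
proof -
  have angles: "\<phi> < pi / 2" "\<psi> < pi / 2"
    using A D by (simp_all add: m_sectorial_def)
  obtain \<theta> where \<theta>: "\<tau> < \<theta>" "\<theta> < pi - \<tau>"
    and "relative_bound C A * relative_bound B D < sin (\<theta> - \<phi>) * sin (\<theta> + \<psi>)"
    using angle_near_theta0[OF phi(1) angles(1) psi(1) angles(2) small] by blast
  moreover have s: "0 < sin (\<theta> - \<phi>)" "0 < sin (\<theta> + \<psi>)"
    using \<theta> phi psi by (auto intro!: sin_gt_zero)
  \<comment> \<open>The slack t allows for relative bounds that are not attained, while the product
    stays below that of the sines.\<close>
  moreover have "((\<lambda>t. (relative_bound C A + t) * (relative_bound B D + t)) \<longlongrightarrow>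
      (relative_bound C A + 0) * (relative_bound B D + 0)) (at_right 0)"
    by (intro tendsto_intros)
  ultimately have "\<forall>\<^sub>F t in at_right 0. (relative_bound C A + t) * (relative_bound B D + t)
      < sin (\<theta> - \<phi>) * sin (\<theta> + \<psi>)"
    using order_tendstoD(2) by fastforce
  then have "\<forall>\<^sub>F t in at_right 0. (relative_bound C A + t) * (relative_bound B D + t)
      < sin (\<theta> - \<phi>) * sin (\<theta> + \<psi>) \<and> 0 < t"
    by (rule eventually_conj) (rule eventually_at_right_less)
  then obtain t where t: "0 < t"
    "(relative_bound C A + t) * (relative_bound B D + t) < sin (\<theta> - \<phi>) * sin (\<theta> + \<psi>)"
    using eventually_happens[of _ "at_right (0 :: real)"] by auto
  obtain a\<^sub>A b\<^sub>A where CA: "rel_bound_consts C A a\<^sub>A b\<^sub>A" "b\<^sub>A < relative_bound C A + t"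
    using rel_bound_consts_near_relative_bound[OF rel(1)] t(1) by (metis less_add_same_cancel1)
  obtain a\<^sub>D b\<^sub>D where BD: "rel_bound_consts B D a\<^sub>D b\<^sub>D" "b\<^sub>D < relative_bound B D + t"
    using rel_bound_consts_near_relative_bound[OF rel(2)] t(1) by (metis less_add_same_cancel1)
  have nonneg: "0 \<le> a\<^sub>A" "0 \<le> b\<^sub>A" "0 \<le> a\<^sub>D" "0 \<le> b\<^sub>D"
    using CA BD by (simp_all add: rel_bound_consts_def)
  have "b\<^sub>A * b\<^sub>D \<le> (relative_bound C A + t) * (relative_bound B D + t)"
    using CA BD nonneg by (intro mult_mono) auto
  then have bb: "b\<^sub>A / sin (\<theta> - \<phi>) * (b\<^sub>D / sin (\<theta> + \<psi>)) < 1"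
    using t(2) s by (simp add: field_simps)
  define p where "p r = (a\<^sub>A / r + b\<^sub>A) / sin (\<theta> - \<phi>)" for r
  define q where "q r = (a\<^sub>D / r + b\<^sub>D) / sin (\<theta> + \<psi>)" for r
  have "((\<lambda>r. p r * q r) \<longlongrightarrow> (0 + b\<^sub>A) / sin (\<theta> - \<phi>) * ((0 + b\<^sub>D) / sin (\<theta> + \<psi>))) at_top"
    unfolding p_def q_def using s
    by (intro tendsto_intros tendsto_divide_0[OF tendsto_const] filterlim_at_top_imp_at_infinity
        filterlim_ident) auto
  then have "\<forall>\<^sub>F r in at_top. p r * q r < 1"
    using bb by (intro order_tendstoD(2)) auto
  then have "\<forall>\<^sub>F r in at_top. p r * q r < 1 \<and> 0 < r"
    by (rule eventually_conj) (rule eventually_gt_at_top)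
  then obtain r where r: "p r * q r < 1" "0 < r"
    using eventually_happens[of _ "at_top :: real filter"] by auto
  define l where "l = complex_of_real r * cis \<theta>"
  \<comment> \<open>The sectorial operator is -D, so D - l is handled as -(-D - (-l)); the point -l
    has argument \<theta> - \<pi>.\<close>
  have ml: "- l = complex_of_real r * cis (\<theta> - pi)"
    by (simp add: l_def complex_eq_iff cos_diff sin_diff)
  have abs: "\<bar>\<theta>\<bar> = \<theta>" "\<bar>\<theta> - pi\<bar> = pi - \<theta>"
    using \<theta> phi psi by auto
  \<comment> \<open>The two sines cover the two signs of cos \<theta>; together they place l
    strictly off the double sector.\<close>
  have "0 < sin (\<theta> - \<tau>)" "0 < sin (\<theta> + \<tau>)"
    using \<theta> tau by (auto intro!: sin_gt_zero)
  then have "\<bar>cos \<theta>\<bar> * sin \<tau> < sin \<theta> * cos \<tau>"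
    by (simp add: sin_diff sin_add abs_if)
  moreover have "0 < sin \<theta>"
    using \<theta> tau by (intro sin_gt_zero) auto
  ultimately have l_cone: "\<bar>Re l\<bar> * sin \<tau> < \<bar>Im l\<bar> * cos \<tau>"
    using r(2) by (simp add: l_def abs_mult mult.assoc)
  then have "l \<in> gap" by (simp add: gap_def)
  have "l \<notin> uminus ` sector \<tau> \<union> sector \<tau>"
    unfolding mem_double_sector_iff[OF tau] using l_cone by simp
  then have "l \<notin> sector \<tau>" "- l \<notin> sector \<tau>"
    by (auto simp: image_iff)
  then have notin: "l \<notin> sector \<phi>" "- l \<notin> sector \<psi>"
    using sector_mono[of \<phi> \<tau>] sector_mono[of \<psi> \<tau>] by auto
  have neg_eq: "neg_op D \<cdot> y - (- l) *\<^sub>C y = - (shift_op D l \<cdot> y)" if "y \<in> dom D" for y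
    using that by (simp add: neg_op_app shift_op_app scaleC_minus_left del: domIff)
  have surjA: "\<exists>x\<in>dom (shift_op A l). shift_op A l \<cdot> x = g" for g
    using m_sectorial_resolvent_set[OF linear(1) A] notin(1) resolvent_set_surj[of l A g]
    by (auto simp: shift_op_app simp del: domIff)
  have surjD: "\<exists>y\<in>dom (shift_op D l). shift_op D l \<cdot> y = h" for h
  proof -
    obtain y where "y \<in> dom D" "neg_op D \<cdot> y - (- l) *\<^sub>C y = - h"
      using m_sectorial_resolvent_set[OF neg_D(1) D] notin(2)
        resolvent_set_surj[of "- l" "neg_op D" "- h"]
      unfolding dom_neg_op by blast
    then show ?thesis
      using neg_eq by (intro bexI[of _ y]) auto
  qed
  have C: "norm (C \<cdot> x) \<le> p r * norm (shift_op A l \<cdot> x)" if "x \<in> dom A" for x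
    using rel_bounded_resolvent_estimate[OF linear(1) sector_A phi that, of \<theta> r C] \<theta> r CA
    by (simp add: p_def l_def shift_op_app[OF that] abs)
  have B: "norm (B \<cdot> y) \<le> q r * norm (shift_op D l \<cdot> y)" if y: "y \<in> dom D" for y
  proof -
    have "rel_bound_consts B (neg_op D) a\<^sub>D b\<^sub>D"
      using BD(1) by (auto simp: rel_bound_consts_def neg_op_app simp del: domIff)
    \<comment> \<open>The second factor of \<open>M_theta0\<close> arises here: -l makes the angle
      \<pi> - \<theta> with the positive axis, hence \<pi> - \<theta> - \<psi> with the sector of
      -D.\<close>
    moreover have "sin (pi - \<theta> - \<psi>) = sin (\<theta> + \<psi>)"
      using sin_pi_minus[of "\<theta> + \<psi>"] by (simp add: algebra_simps)
    ultimately have "norm (B \<cdot> y) \<le> q r * norm (neg_op D \<cdot> y - (- l) *\<^sub>C y)"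
      using rel_bounded_resolvent_estimate[OF neg_D psi, of y "\<theta> - pi" r B a\<^sub>D b\<^sub>D] \<theta> r y
      unfolding ml abs dom_neg_op by (simp add: q_def del: domIff)
    then show ?thesis unfolding neg_eq[OF y] norm_minus_cancel .
  qed
  show ?thesis
  proof (rule gap_subset_resolvent_set[OF \<open>l \<in> gap\<close>])
    fix g :: "'a \<times> 'b"
    have "\<exists>x\<in>dom (shift_op A l). \<exists>y\<in>dom (shift_op D l).
        shift_op A l \<cdot> x + B \<cdot> y = fst g \<and> C \<cdot> x + shift_op D l \<cdot> y = snd g"
    proof (rule block_system_solvable[OF linear_operator_shift_op linear_operator_shift_op])
      show "dom (shift_op A l) \<subseteq> dom C" "dom (shift_op D l) \<subseteq> dom B"
        using rel by (auto simp: rel_bounded_def simp del: domIff)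
      show "0 \<le> p r" "0 \<le> q r" "p r * q r < 1"
        using nonneg s r by (simp_all add: p_def q_def)
    qed (use linear surjA surjD C B in \<open>auto simp del: domIff\<close>)
    then obtain x y where xy: "x \<in> dom A" "y \<in> dom D"
      "shift_op A l \<cdot> x + B \<cdot> y = fst g" "C \<cdot> x + shift_op D l \<cdot> y = snd g"
      by auto
    then have dom: "x \<in> dom A \<inter> dom C" "y \<in> dom B \<inter> dom D"
      using rel by (auto simp: rel_bounded_def simp del: domIff)
    have "block_op A B C D \<cdot> (x, y) - l *\<^sub>C (x, y) = g"
      using xy(3,4) unfolding block_op_app[OF dom]
      by (simp add: shift_op_app[OF xy(1)] shift_op_app[OF xy(2)] scaleC_prod_def prod_eq_iff
          algebra_simps)
    moreover have "(x, y) \<in> dom (block_op A B C D)"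
      using dom by (simp add: dom_block_op del: domIff)
    ultimately show "\<exists>f\<in>dom (block_op A B C D). block_op A B C D \<cdot> f - l *\<^sub>C f = g" ..
  qed
qed

section \<open>The case of boundedly invertible off-diagonal entries\<close>

text \<open>With x = \<open>B \<cdot> y\<close> the adjoint relation turns the squared norm of x
  into the pairing of y with \<open>C \<cdot> x\<close>, and y is bounded through the inverse of B.
  Thus the norm of this one inverse serves both columns, as in the smallness condition.\<close>

lemma norm_le_onorm_inverse_op:
  assumes B: "boundedly_invertible B" and x: "x \<in> dom C"
  shows "norm x \<le> onorm (inverse_op B) * norm (C \<cdot> x)"
proof (cases "x = 0")
  case False
  obtain y where y: "y \<in> dom B" "B \<cdot> y = x"
    using B by (rule boundedly_invertible_surj)
  have "inverse_op B x = y"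
    using B y the_inv_into_f_f[of "\<lambda>x. B \<cdot> x" "dom B" y]
    by (simp add: inverse_op_def boundedly_invertible_def bij_betw_def del: domIff)
  then have "norm y \<le> onorm (inverse_op B) * norm x"
    using onorm[of "inverse_op B" x] B by (simp add: boundedly_invertible_def)
  moreover have "(norm x)\<^sup>2 \<le> norm y * norm (C \<cdot> x)"
  proof -
    have "complex_of_real ((norm x)\<^sup>2) = cinner y (C \<cdot> x)"
      using cinner_adjoint_restriction[OF dense_B C_sub x y(1)] unfolding y(2) cinner_self .
    then show ?thesis
      using norm_cinner_le[of y "C \<cdot> x"] by (metis norm_of_real abs_of_nonneg zero_le_power2)
  qed
  ultimately have "norm x * norm x \<le> (onorm (inverse_op B) * norm x) * norm (C \<cdot> x)"
    unfolding power2_eq_square by (meson mult_right_mono norm_ge_zero order_trans)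
  then have "norm x * norm x \<le> (onorm (inverse_op B) * norm (C \<cdot> x)) * norm x"
    by (simp add: mult_ac)
  then show ?thesis using False by simp
next
  case True
  then show ?thesis
    using B onorm_pos_le[of "inverse_op B"] by (simp add: boundedly_invertible_def)
qed

text \<open>At the point 0 the off-diagonal entries are inverted: A is bounded by C and D by B, with
  the two square roots as constants and their product as the contraction factor.\<close>

lemma gap_subset_resolvent_set_accretive:
  assumes dom: "dom C \<subseteq> dom A" "dom B \<subseteq> dom D"
    and B: "boundedly_invertible B" and C: "boundedly_invertible C"
    and est_A: "\<And>x. x \<in> dom C \<Longrightarrow> (norm (A \<cdot> x))\<^sup>2 \<le> a\<^sub>C\<^sup>2 * (norm x)\<^sup>2 + b\<^sub>C\<^sup>2 * (norm (C \<cdot> x))\<^sup>2"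
    and est_D: "\<And>y. y \<in> dom B \<Longrightarrow> (norm (D \<cdot> y))\<^sup>2 \<le> a\<^sub>B\<^sup>2 * (norm y)\<^sup>2 + b\<^sub>B\<^sup>2 * (norm (B \<cdot> y))\<^sup>2"
    and small: "sqrt (a\<^sub>C\<^sup>2 * (onorm (inverse_op B))\<^sup>2 + b\<^sub>C\<^sup>2)
      * sqrt (a\<^sub>B\<^sup>2 * (onorm (inverse_op B))\<^sup>2 + b\<^sub>B\<^sup>2) < 1"
  shows "gap \<subseteq> resolvent_set (block_op A B C D)"
proof (rule gap_subset_resolvent_set)
  show "0 \<in> gap" using signs by (simp add: gap_def)
  let ?N = "onorm (inverse_op B)"
  \<comment> \<open>Inserting n \<le> \<open>?N * w\<close> into the quadratic estimate absorbs the
    norm of the vector into that of its image.\<close>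
  have sqrt_est: "t \<le> sqrt (a\<^sup>2 * ?N\<^sup>2 + b\<^sup>2) * w"
    if "t\<^sup>2 \<le> a\<^sup>2 * n\<^sup>2 + b\<^sup>2 * w\<^sup>2" "0 \<le> n" "n \<le> ?N * w" "0 \<le> w" for t a b n w :: real
  proof (rule power2_le_imp_le)
    have "n\<^sup>2 \<le> (?N * w)\<^sup>2"
      using that by (intro power_mono) auto
    then have "t\<^sup>2 \<le> a\<^sup>2 * (?N * w)\<^sup>2 + b\<^sup>2 * w\<^sup>2"
      using that(1) mult_left_mono[of "n\<^sup>2" "(?N * w)\<^sup>2" "a\<^sup>2"] by simp
    then show "t\<^sup>2 \<le> (sqrt (a\<^sup>2 * ?N\<^sup>2 + b\<^sup>2) * w)\<^sup>2"
      by (simp add: power_mult_distrib algebra_simps)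
    show "0 \<le> sqrt (a\<^sup>2 * ?N\<^sup>2 + b\<^sup>2) * w"
      using that(4) by simp
  qed
  fix g :: "'a \<times> 'b"
  \<comment> \<open>The rows are swapped, so that C and B form the diagonal of the system.\<close>
  have "\<exists>x\<in>dom C. \<exists>y\<in>dom B. C \<cdot> x + D \<cdot> y = snd g \<and> A \<cdot> x + B \<cdot> y = fst g"
  proof (rule block_system_solvable[OF linear(3,2,1,4)])
    show "norm (A \<cdot> x) \<le> sqrt (a\<^sub>C\<^sup>2 * ?N\<^sup>2 + b\<^sub>C\<^sup>2) * norm (C \<cdot> x)" if "x \<in> dom C" for x
      using sqrt_est[OF est_A[OF that] _ norm_le_onorm_inverse_op[OF B that]] by simp
    show "norm (D \<cdot> y) \<le> sqrt (a\<^sub>B\<^sup>2 * ?N\<^sup>2 + b\<^sub>B\<^sup>2) * norm (B \<cdot> y)" if y: "y \<in> dom B" for y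
    proof (rule sqrt_est[OF est_D[OF y]])
      have "inverse_op B (B \<cdot> y) = y"
        using B y the_inv_into_f_f[of "\<lambda>x. B \<cdot> x" "dom B" y]
        by (simp add: inverse_op_def boundedly_invertible_def bij_betw_def del: domIff)
      then show "norm y \<le> ?N * norm (B \<cdot> y)"
        using onorm[of "inverse_op B" "B \<cdot> y"] B by (simp add: boundedly_invertible_def)
    qed simp_all
    show "\<exists>x\<in>dom C. C \<cdot> x = h" for h
      using boundedly_invertible_surj[OF C] by metis
    show "\<exists>y\<in>dom B. B \<cdot> y = h" for h
      using boundedly_invertible_surj[OF B] by metis
  qed (use dom small in \<open>auto simp del: domIff\<close>)
  then obtain x y where xy: "x \<in> dom C" "y \<in> dom B" "C \<cdot> x + D \<cdot> y = snd g" "A \<cdot> x + B \<cdot> y = fst g"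
    by blast
  then have dom': "x \<in> dom A \<inter> dom C" "y \<in> dom B \<inter> dom D"
    using dom by blast+
  have "block_op A B C D \<cdot> (x, y) - 0 *\<^sub>C (x, y) = g"
    unfolding block_op_app[OF dom'] using xy(3,4) by simp
  moreover have "(x, y) \<in> dom (block_op A B C D)"
    using dom' by (simp add: dom_block_op del: domIff)
  ultimately show "\<exists>f\<in>dom (block_op A B C D). block_op A B C D \<cdot> f - 0 *\<^sub>C f = g" ..
qed

end

theorem proposition6p5:
  fixes A :: "'a::chilbert_space \<rightharpoonup> 'a"
    and B :: "'b::chilbert_space \<rightharpoonup> 'a"
    and C :: "'a \<rightharpoonup> 'b"
    and D :: "'b \<rightharpoonup> 'b"
    and \<alpha> \<delta> \<phi> \<psi> \<tau> :: real
    and \<Sigma> :: "complex set"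
  assumes linear: "linear_operator A" "linear_operator B" "linear_operator C" "linear_operator D"
    and dense: "densely_defined A" "densely_defined B" "densely_defined C" "densely_defined D"
    and closable: "closable A" "closable B" "closable C" "closable D"
    and dense_block: "densely_defined (block_op A B C D)"
    and C_sub: "C \<subseteq>\<^sub>m adjoint_op B"
    and phi: "\<phi> \<in> {0..pi / 2}"
    and psi: "\<psi> \<in> {0..pi / 2}"
    and signs: "\<delta> < 0" "0 < \<alpha>"
    and Re_D: "\<forall>z\<in>numerical_range D. Re z \<le> \<delta>"
    and Re_A: "\<forall>z\<in>numerical_range A. \<alpha> \<le> Re z"
    and sector_A: "numerical_range A \<subseteq> sector \<phi>"
    and sector_D: "numerical_range D \<subseteq> uminus ` sector \<psi>"
    and tau: "\<tau> = max \<phi> \<psi>"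
    and cases:
      "(m_sectorial \<phi> A \<and> m_sectorial \<psi> (neg_op D)
        \<and> rel_bounded C A \<and> rel_bounded B D
        \<and> relative_bound C A * relative_bound B D < M_theta0 \<phi> \<psi>)
      \<or>
       (m_accretive A \<and> m_accretive (neg_op D)
        \<and> C = adjoint_op B
        \<and> rel_bounded A C \<and> rel_bounded D B
        \<and> relative_bound D B * relative_bound A C < 1
        \<and> boundedly_invertible B \<and> boundedly_invertible C
        \<and> (\<exists>a\<^sub>C a\<^sub>B b\<^sub>C b\<^sub>B. 0 \<le> a\<^sub>C \<and> 0 \<le> a\<^sub>B \<and> 0 \<le> b\<^sub>C \<and> 0 \<le> b\<^sub>B
            \<and> (\<forall>x\<in>dom C. (norm (A \<cdot> x))\<^sup>2 \<le> a\<^sub>C\<^sup>2 * (norm x)\<^sup>2 + b\<^sub>C\<^sup>2 * (norm (C \<cdot> x))\<^sup>2)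
            \<and> (\<forall>y\<in>dom B. (norm (D \<cdot> y))\<^sup>2 \<le> a\<^sub>B\<^sup>2 * (norm y)\<^sup>2 + b\<^sub>B\<^sup>2 * (norm (B \<cdot> y))\<^sup>2)
            \<and> sqrt (a\<^sub>C\<^sup>2 * (onorm (inverse_op B))\<^sup>2 + b\<^sub>C\<^sup>2)
                * sqrt (a\<^sub>B\<^sup>2 * (onorm (inverse_op B))\<^sup>2 + b\<^sub>B\<^sup>2) < 1))"
    and Sigma: "\<Sigma> = (uminus ` sector \<tau> \<union> sector \<tau>) \<inter> {z. Re z \<notin> {\<delta><..<\<alpha>}}"
  shows "resolvent_set (block_op A B C D) \<inter> (UNIV - \<Sigma>) \<noteq> {} \<and> spectrum (block_op A B C D) \<subseteq> \<Sigma>"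
proof -
  note tau_eq = tau
  interpret block_matrix A B C D \<alpha> \<delta> \<phi> \<psi>
    using linear dense(2) C_sub phi psi signs Re_D Re_A sector_A sector_D
    by unfold_locales auto
  have gap: "gap = UNIV - \<Sigma>"
    unfolding Sigma tau_eq by (rule gap_eq)
  have "gap \<subseteq> resolvent_set (block_op A B C D)"
    using cases
  proof (elim disjE conjE exE)
    assume "m_sectorial \<phi> A" "m_sectorial \<psi> (neg_op D)" "rel_bounded C A" "rel_bounded B D"
      "relative_bound C A * relative_bound B D < M_theta0 \<phi> \<psi>"
    then show ?thesis by (rule gap_subset_resolvent_set_sectorial)
  next
    fix a\<^sub>C a\<^sub>B b\<^sub>C b\<^sub>B
    assume rel: "rel_bounded A C" "rel_bounded D B"
      and inv: "boundedly_invertible B" "boundedly_invertible C"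
      and est: "\<forall>x\<in>dom C. (norm (A \<cdot> x))\<^sup>2 \<le> a\<^sub>C\<^sup>2 * (norm x)\<^sup>2 + b\<^sub>C\<^sup>2 * (norm (C \<cdot> x))\<^sup>2"
        "\<forall>y\<in>dom B. (norm (D \<cdot> y))\<^sup>2 \<le> a\<^sub>B\<^sup>2 * (norm y)\<^sup>2 + b\<^sub>B\<^sup>2 * (norm (B \<cdot> y))\<^sup>2"
        "sqrt (a\<^sub>C\<^sup>2 * (onorm (inverse_op B))\<^sup>2 + b\<^sub>C\<^sup>2)
          * sqrt (a\<^sub>B\<^sup>2 * (onorm (inverse_op B))\<^sup>2 + b\<^sub>B\<^sup>2) < 1"
    show ?thesis
      using rel est(1,2)
      by (intro gap_subset_resolvent_set_accretive[OF _ _ inv _ _ est(3)])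
        (simp_all add: rel_bounded_def del: domIff)
  qed
  \<comment> \<open>This point lies outside \<Sigma>, so the inclusion also yields the first
    claim.\<close>
  moreover have "0 \<in> gap"
    using signs by (simp add: gap_def)
  ultimately show ?thesis
    unfolding gap spectrum_def by blast
qed

end
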